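(* Let $K$ be a field of characteristic $0$ and let $n \ge 5$. Let $\mathcal{A} \subseteq (\mathbb{Z}_{\ge 0})^n$ be a homogeneous support set which is symmetric, i.e., every permutation of (the coordinates of) an element of $\mathcal{A}$ also lies in $\mathcal{A}$. Let $k$ be the minimal number of strictly positive entries among all elements of $\mathcal{A}$. Then for general coefficients of $f \in K^{\mathcal{A}}$ with respect to $\mathcal{A}$, $$\sqrt{(S_n.f)} = (S_n.\,x_1x_2\cdots x_k).$$ In particular, the common zero set of $S_n.f$ consists of all points of $\overline{K}^n$ with at least $n-k+1$ zero entries.
   Context: A support set is a non-empty finite subset $\mathcal{A}\subseteq(\mathbb{Z}_{\ge0})^n$; monomials are identified with exponent vectors; $\mathcal{A}$ is homogeneous if all its elements have the same coordinate sum. $K^{\mathcal{A}}$ is identified with the polynomials whose support is contained in $\mathcal{A}$. $S_n$ acts by $\sigma.x_i = x_{\sigma(i)}$; $S_n.f$ is the orbit and $(S_n.f)$ the ideal it generates; $(S_n.\,x_1\cdots x_k)$ is the ideal generated by all square-free monomials of degree $k$. "For general coefficients of $f$ with respect to $\mathcal{A}$" means: the set of $f\in K^{\mathcal{A}}$ for which the assertion holds contains a non-empty Zariski-open subset of $K^{\mathcal{A}}$. *)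

theory Defs
  imports "HOL-Library.Poly_Mapping" "HOL-Combinatorics.Permutations"
begin

text \<open>Multivariate polynomials in the variables x_0, x_1, ... over a ring 'k:
  exponent vectors are finitely supported maps nat =>0 nat, polynomials are
  finitely supported maps from exponent vectors to coefficients (convolution product).
  Polynomials in n variables are those whose exponent vectors have keys in {..<n}.\<close>

type_synonym 'k mpoly = "(nat \<Rightarrow>\<^sub>0 nat) \<Rightarrow>\<^sub>0 'k"

definition exp_deg :: "(nat \<Rightarrow>\<^sub>0 nat) \<Rightarrow> nat" where
  "exp_deg \<alpha> = (\<Sum>i\<in>Poly_Mapping.keys \<alpha>. Poly_Mapping.lookup \<alpha> i)"

text \<open>Action of a permutation on exponent vectors, induced by sigma.x_i = x_(sigma i):
  the exponent of x_(sigma i) in sigma.m equals the exponent of x_i in m.\<close>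
definition perm_exp :: "(nat \<Rightarrow> nat) \<Rightarrow> (nat \<Rightarrow>\<^sub>0 nat) \<Rightarrow> (nat \<Rightarrow>\<^sub>0 nat)" where
  "perm_exp \<sigma> \<alpha> = Poly_Mapping.map_key (inv \<sigma>) \<alpha>"

definition perm_poly :: "(nat \<Rightarrow> nat) \<Rightarrow> 'k::comm_ring_1 mpoly \<Rightarrow> 'k mpoly" where
  "perm_poly \<sigma> f = (\<Sum>\<alpha>\<in>Poly_Mapping.keys f. Poly_Mapping.single (perm_exp \<sigma> \<alpha>) (Poly_Mapping.lookup f \<alpha>))"

definition Sn_orbit :: "nat \<Rightarrow> 'k::comm_ring_1 mpoly \<Rightarrow> 'k mpoly set" where
  "Sn_orbit n f = {perm_poly \<sigma> f | \<sigma>. \<sigma> permutes {..<n}}"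

definition ideal_gen :: "'a::comm_ring_1 set \<Rightarrow> 'a set" where
  "ideal_gen S = {p. \<exists>F h. finite F \<and> F \<subseteq> S \<and> p = (\<Sum>s\<in>F. h s * s)}"

definition radical :: "'a::comm_ring_1 set \<Rightarrow> 'a set" where
  "radical I = {p. \<exists>m. p ^ m \<in> I}"

definition poly_of_coeffs :: "(nat \<Rightarrow>\<^sub>0 nat) set \<Rightarrow> ((nat \<Rightarrow>\<^sub>0 nat) \<Rightarrow> 'k::comm_ring_1) \<Rightarrow> 'k mpoly" where
  "poly_of_coeffs A c = (\<Sum>\<alpha>\<in>A. Poly_Mapping.single \<alpha> (c \<alpha>))"

definition sqfree_mono :: "nat \<Rightarrow> 'k::comm_ring_1 mpoly" where
  "sqfree_mono k = Poly_Mapping.single (\<Sum>i<k. Poly_Mapping.single i 1) 1"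

definition eval_poly :: "(('v \<Rightarrow>\<^sub>0 nat) \<Rightarrow>\<^sub>0 'k::comm_ring_1) \<Rightarrow> ('v \<Rightarrow> 'k) \<Rightarrow> 'k" where
  "eval_poly P c = (\<Sum>m\<in>Poly_Mapping.keys P. Poly_Mapping.lookup P m * (\<Prod>v\<in>Poly_Mapping.keys m. c v ^ Poly_Mapping.lookup m v))"

text \<open>"For general coefficients with respect to A": the set of coefficient vectors in K^A
  for which Q holds contains a non-empty Zariski open subset. Since K is infinite here,
  this is the same as containing a basic open set D(P) for a nonzero polynomial P in the
  coefficient variables (indexed by A).\<close>
definition general_coeffs :: "(nat \<Rightarrow>\<^sub>0 nat) set \<Rightarrow> (((nat \<Rightarrow>\<^sub>0 nat) \<Rightarrow> 'k::comm_ring_1) \<Rightarrow> bool) \<Rightarrow> bool" where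
  "general_coeffs A Q \<longleftrightarrow>
     (\<exists>P :: ((nat \<Rightarrow>\<^sub>0 nat) \<Rightarrow>\<^sub>0 nat) \<Rightarrow>\<^sub>0 'k. P \<noteq> 0 \<and> (\<forall>m\<in>Poly_Mapping.keys P. Poly_Mapping.keys m \<subseteq> A) \<and>
        (\<forall>c. eval_poly P c \<noteq> 0 \<longrightarrow> Q c))"

end

theory Submission
  imports Defs "Jordan_Normal_Form.Determinant"
begin

text \<open>
  Let the coefficients \<open>c\<^sub>\<alpha>\<close> be indeterminates and let \<open>f\<close> be the generic polynomial.  It suffices to
  show that the ideal of the orbit contains \<open>p (x\<^sub>1 \<cdots> x\<^sub>k)\<^sup>N\<close> for some nonzero \<open>p \<in> K[c]\<close>, because one can
  then specialise \<open>c\<close> to any point where \<open>p\<close> does not vanish.  Otherwise some prime \<open>P\<close> of \<open>K[c, x]\<close>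
  contains the orbit but neither \<open>x\<^sub>1, \<dots>, x\<^sub>k\<close> nor any nonzero element of \<open>K[c]\<close>.  In characteristic 0
  every derivation of \<open>K[c]\<close> extends, up to a factor outside \<open>P\<close>, to a derivation of \<open>K[c, x]\<close> preserving
  \<open>P\<close>.  Do this for the derivations \<open>c\<^sub>\<beta> \<mapsto> \<beta>\<^sub>j c\<^sub>\<beta>\<close> and apply the result to \<open>\<sigma>.f = \<Sum>\<^sub>\<beta> c\<^sub>\<beta> x\<^bsup>\<sigma>\<beta>\<^esup> \<in> P\<close>:
  modulo \<open>P\<close>, the moment vector \<open>\<mu> = \<Sum>\<^sub>\<beta> c\<^sub>\<beta> x\<^bsup>\<sigma>\<beta>\<^esup> \<beta>\<close> is nonzero, has coordinate sum 0 by homogeneity,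
  and lies in the kernel of \<open>diag(q) + L\<sigma>\<close> with \<open>L\<close> independent of \<open>\<sigma>\<close>.  Since only coordinate sum 0
  matters, the rows of \<open>L\<close> may be assumed to sum to 0; but then the determinants
  of these matrices add up over all \<open>\<sigma>\<close> to \<open>n! \<Prod>\<^sub>j q\<^sub>j\<close>, which is not in \<open>P\<close>.
\<close>

section \<open>Ideals and prime ideals\<close>

locale ring_ideal =
  fixes I :: "'a::comm_ring_1 set"
  assumes zero: "0 \<in> I"
    and add: "a \<in> I \<Longrightarrow> b \<in> I \<Longrightarrow> a + b \<in> I"
    and mult: "a \<in> I \<Longrightarrow> r * a \<in> I"
begin

lemma mult_right: "a \<in> I \<Longrightarrow> a * r \<in> I"
  using mult[of a r] by (simp add: mult.commute)

lemma uminus: "a \<in> I \<Longrightarrow> - a \<in> I"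
  using mult[of a "- 1"] by simp

lemma diff: "a \<in> I \<Longrightarrow> b \<in> I \<Longrightarrow> a - b \<in> I"
  using add[of a "- b"] uminus[of b] by simp

lemma sum: "(\<And>i. i \<in> J \<Longrightarrow> f i \<in> I) \<Longrightarrow> sum f J \<in> I"
  by (induction J rule: infinite_finite_induct) (auto intro: zero add)

lemma add_cancel_right: "a + b \<in> I \<Longrightarrow> b \<in> I \<Longrightarrow> a \<in> I"
  using diff[of "a + b" b] by simp

end

locale prime_ring_ideal = ring_ideal +
  assumes one_notin: "1 \<notin> I"
    and prime: "a * b \<in> I \<Longrightarrow> a \<in> I \<or> b \<in> I"
begin

lemma power_in: "a ^ m \<in> I \<Longrightarrow> a \<in> I"
  by (induction m) (use one_notin prime in auto)

lemma prod_in: "prod f J \<in> I \<Longrightarrow> \<exists>i\<in>J. f i \<in> I"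
  by (induction J rule: infinite_finite_induct) (use one_notin prime in auto)

end

text \<open>Zorn's lemma gives an ideal maximal among those that contain \<open>I\<close> and miss
  \<open>M\<close>. It is prime: enlarging it by \<open>a\<close> or by \<open>b\<close> would meet
  \<open>M\<close>, and the product of the two witnesses would lie in the ideal if
  \<open>a * b\<close> did.\<close>

lemma prime_ring_ideal_avoiding:
  fixes I M :: "'a::comm_ring_1 set"
  assumes I: "ring_ideal I" and M1: "1 \<in> M"
    and M_mult: "\<And>a b. a \<in> M \<Longrightarrow> b \<in> M \<Longrightarrow> a * b \<in> M"
    and disj: "I \<inter> M = {}"
  obtains P where "prime_ring_ideal P" "I \<subseteq> P" "P \<inter> M = {}"
proof -
  define \<C> where "\<C> = {J. ring_ideal J \<and> I \<subseteq> J \<and> J \<inter> M = {}}"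
  have "\<exists>P\<in>\<C>. \<forall>X\<in>\<C>. P \<subseteq> X \<longrightarrow> X = P"
  proof (rule subset_Zorn_nonempty)
    show "\<C> \<noteq> {}" using I disj by (auto simp: \<C>_def)
  next
    fix C assume C: "C \<noteq> {}" "subset.chain \<C> C"
    have sub: "C \<subseteq> \<C>" using C(2) by (auto simp: subset_chain_def)
    have id: "ring_ideal J" if "J \<in> C" for J using sub that by (auto simp: \<C>_def)
    have "ring_ideal (\<Union>C)"
    proof
      show "0 \<in> \<Union>C" using C(1) id ring_ideal.zero by blast
    next
      fix a b assume "a \<in> \<Union>C" "b \<in> \<Union>C"
      then obtain J J' where J: "a \<in> J" "J \<in> C" "b \<in> J'" "J' \<in> C" by blast
      have "J \<subseteq> J' \<or> J' \<subseteq> J" using C(2) J by (auto simp: subset_chain_def)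
      then show "a + b \<in> \<Union>C"
        using J id ring_ideal.add by (metis Union_iff subset_iff)
    next
      fix a r assume "a \<in> \<Union>C"
      then show "r * a \<in> \<Union>C" using id ring_ideal.mult by blast
    qed
    then show "\<Union>C \<in> \<C>" using sub C(1) by (fastforce simp: \<C>_def)
  qed
  then obtain P where P: "P \<in> \<C>" and max: "\<And>X. X \<in> \<C> \<Longrightarrow> P \<subseteq> X \<Longrightarrow> X = P" by blast
  interpret P: ring_ideal P using P by (simp add: \<C>_def)
  have meets: "\<exists>p\<in>P. \<exists>r. p + r * a \<in> M" if "a \<notin> P" for a
  proof -
    define Q where "Q = {p + r * a | p r. p \<in> P}"
    have Q: "ring_ideal Q"
    proof
      show "0 \<in> Q" unfolding Q_def using P.zero by (auto intro!: exI[of _ 0])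
    next
      fix x y assume "x \<in> Q" "y \<in> Q"
      then obtain p r p' r' where "x = p + r * a" "y = p' + r' * a" "p \<in> P" "p' \<in> P"
        by (auto simp: Q_def)
      then have "x + y = (p + p') + (r + r') * a" "p + p' \<in> P"
        by (auto simp: algebra_simps P.add)
      then show "x + y \<in> Q" unfolding Q_def by blast
    next
      fix x s assume "x \<in> Q"
      then obtain p r where "x = p + r * a" "p \<in> P" by (auto simp: Q_def)
      then have "s * x = s * p + (s * r) * a" "s * p \<in> P"
        using P.mult[of p s] by (auto simp: distrib_left mult.assoc)
      then show "s * x \<in> Q" unfolding Q_def by blast
    qed
    have PQ: "P \<subseteq> Q"
    proof
      fix p assume "p \<in> P"
      then show "p \<in> Q" unfolding Q_def mem_Collect_eq by (intro exI[of _ p] exI[of _ 0]) auto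
    qed
    have "a \<in> Q" unfolding Q_def mem_Collect_eq using P.zero by (intro exI[of _ 0] exI[of _ 1]) auto
    with that PQ max[of Q] have "Q \<notin> \<C>" by blast
    then have "Q \<inter> M \<noteq> {}" using Q PQ P by (auto simp: \<C>_def)
    then show ?thesis by (auto simp: Q_def)
  qed
  have "prime_ring_ideal P"
  proof
    show "1 \<notin> P" using P M1 by (auto simp: \<C>_def)
  next
    fix a b assume ab: "a * b \<in> P"
    show "a \<in> P \<or> b \<in> P"
    proof (rule ccontr)
      assume "\<not> ?thesis"
      then obtain p r p' r' where *: "p \<in> P" "p + r * a \<in> M" "p' \<in> P" "p' + r' * b \<in> M"
        using meets[of a] meets[of b] by blast
      have "(p + r * a) * (p' + r' * b) = (p' + r' * b) * p + (r * a) * p' + (r * r') * (a * b)"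
        by (simp add: algebra_simps)
      moreover have "\<dots> \<in> P" using * ab P.mult by (metis P.add)
      moreover have "(p + r * a) * (p' + r' * b) \<in> M" using * M_mult by blast
      ultimately show False using P by (auto simp: \<C>_def)
    qed
  qed
  then show ?thesis using that P by (auto simp: \<C>_def)
qed

section \<open>Extending derivations modulo a prime ideal\<close>

locale derivation =
  fixes D :: "'a::comm_ring_1 \<Rightarrow> 'a"
  assumes add: "D (a + b) = D a + D b"
    and mult: "D (a * b) = a * D b + b * D a"
begin

lemma zero: "D 0 = 0"
  using add[of 0 0] by simp

lemma one: "D 1 = 0"
  using mult[of 1 1] by simp

lemma uminus: "D (- a) = - D a"
  using add[of a "- a"] zero by (simp add: add_eq_0_iff)

lemma diff: "D (a - b) = D a - D b"
  using add[of a "- b"] uminus[of b] by simp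

lemma sum: "D (sum f J) = (\<Sum>i\<in>J. D (f i))"
  by (induction J rule: infinite_finite_induct) (auto simp: zero add)

end

lemma derivation_smult: "derivation D \<Longrightarrow> derivation (\<lambda>a. q * D a)"
  by (auto simp: derivation_def algebra_simps)

lemma derivation_plus: "derivation D \<Longrightarrow> derivation E \<Longrightarrow> derivation (\<lambda>a. D a + E a)"
  by (auto simp: derivation_def algebra_simps)

lemma derivation_sum:
  "(\<And>i. i \<in> J \<Longrightarrow> derivation (D i)) \<Longrightarrow> derivation (\<lambda>a. \<Sum>i\<in>J. D i a)"
  by (induction J rule: infinite_finite_induct)
    (auto simp: derivation_plus, auto simp: derivation_def)

section \<open>Subrings as sets, and adjoining one element\<close>

locale subring_set =
  fixes S :: "'a::comm_ring_1 set"
  assumes one: "1 \<in> S"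
    and diff: "a \<in> S \<Longrightarrow> b \<in> S \<Longrightarrow> a - b \<in> S"
    and mult: "a \<in> S \<Longrightarrow> b \<in> S \<Longrightarrow> a * b \<in> S"
begin

lemma zero: "0 \<in> S"
  using diff[OF one one] by simp

lemma add: "a \<in> S \<Longrightarrow> b \<in> S \<Longrightarrow> a + b \<in> S"
  using diff[of a "0 - b"] diff[OF zero, of b] by simp

lemma sum: "(\<And>i. i \<in> J \<Longrightarrow> f i \<in> S) \<Longrightarrow> sum f J \<in> S"
  by (induction J rule: infinite_finite_induct) (auto intro: zero add)

lemma prod: "(\<And>i. i \<in> J \<Longrightarrow> f i \<in> S) \<Longrightarrow> prod f J \<in> S"
  by (induction J rule: infinite_finite_induct) (auto intro: one mult)

lemma power: "a \<in> S \<Longrightarrow> a ^ m \<in> S"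
  by (induction m) (auto intro: one mult)

lemma of_nat: "of_nat m \<in> S"
  by (induction m) (auto intro: zero one add)

lemma coeff_mult: "\<forall>i. coeff p i \<in> S \<Longrightarrow> \<forall>i. coeff q i \<in> S \<Longrightarrow> coeff (p * q) i \<in> S"
  unfolding Polynomial.coeff_mult by (intro sum mult) auto

end

text \<open>The ring \<open>S[X]\<close> inside the ambient ring. Coefficients are constrained by a
  predicate, so that all stages of a tower live in the same type.\<close>

definition adjoin :: "'a::comm_ring_1 set \<Rightarrow> 'a \<Rightarrow> 'a set" where
  "adjoin S X = {poly p X | p. \<forall>i. coeff p i \<in> S}"

context subring_set
begin

lemma subring_adjoin: "subring_set (adjoin S X)"
proof
  show "1 \<in> adjoin S X"
    unfolding adjoin_def using one zero
    by (auto intro!: exI[of _ 1] simp: coeff_1)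
next
  fix a b assume "a \<in> adjoin S X" "b \<in> adjoin S X"
  then obtain p q where pq: "a = poly p X" "b = poly q X" "\<forall>i. coeff p i \<in> S" "\<forall>i. coeff q i \<in> S"
    by (auto simp: adjoin_def)
  then show "a - b \<in> adjoin S X" "a * b \<in> adjoin S X"
    unfolding adjoin_def mem_Collect_eq
    by (intro exI[of _ "p - q"] exI[of _ "p * q"]; auto simp: diff coeff_mult)+
qed

lemma subset_adjoin: "S \<subseteq> adjoin S X"
proof
  fix a assume "a \<in> S"
  then show "a \<in> adjoin S X"
    unfolding adjoin_def using zero
    by (auto intro!: exI[of _ "[:a:]"] simp: coeff_pCons split: nat.split)
qed

lemma generator_in_adjoin: "X \<in> adjoin S X"
  unfolding adjoin_def using zero one
  by (auto intro!: exI[of _ "[:0, 1:]"] simp: coeff_pCons split: nat.split)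

end

lemma coeffs_pCons_iff: "(\<forall>i. coeff (pCons c p) i \<in> S) \<longleftrightarrow> c \<in> S \<and> (\<forall>i. coeff p i \<in> S)"
  by (auto simp: coeff_pCons split: nat.splits)

lemma derivation_zero_on_adjoin:
  assumes "derivation D" "\<And>a. a \<in> S \<Longrightarrow> D a = 0" "D X = 0" "a \<in> adjoin S X"
  shows "D a = 0"
proof -
  interpret derivation D by fact
  have "D (poly p X) = 0" if "\<forall>i. coeff p i \<in> S" for p
    using that
  proof (induction p)
    case (pCons c p)
    then show ?case using assms by (auto simp: coeffs_pCons_iff add mult)
  qed (simp add: zero)
  then show ?thesis using assms(4) by (auto simp: adjoin_def)
qed

text \<open>This extends a derivation across \<open>X\<close> over the fraction field of
  \<open>S/(P \<inter> S)\<close>, freed of denominators; \<open>\<theta>\<close> acts as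
  \<open>X d/dX\<close> on \<open>S[X]\<close>. If \<open>X\<close> is zero or transcendental modulo
  \<open>P\<close>, then \<open>D\<close> itself works. If \<open>X\<close> is algebraic, its
  derivative is forced by a minimal equation, and characteristic 0 makes this equation separable, so
  that the derivative can be solved for.\<close>

lemma derivation_extend:
  fixes D \<theta> :: "'a::idom \<Rightarrow> 'a"
  assumes P: "prime_ring_ideal P" and char: "\<And>e. e > 0 \<Longrightarrow> of_nat e \<notin> P"
    and S: "subring_set S" and D: "derivation D" and \<theta>: "derivation \<theta>"
    and \<theta>S: "\<And>a. a \<in> S \<Longrightarrow> \<theta> a = 0" and \<theta>X: "\<theta> X = X" and DX: "D X = 0"
    and DP: "\<And>a. a \<in> S \<Longrightarrow> a \<in> P \<Longrightarrow> D a \<in> P"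
  shows "\<exists>q y. q \<notin> P \<and> (\<forall>a\<in>adjoin S X. a \<in> P \<longrightarrow> q * D a + y * \<theta> a \<in> P)"
proof -
  interpret P: prime_ring_ideal P by fact
  interpret S: subring_set S by fact
  interpret D: derivation D by fact
  interpret \<theta>: derivation \<theta> by fact
  let ?S = "\<lambda>p. \<forall>i. coeff p i \<in> S"
  \<comment> \<open>Polynomials whose coefficients already lie in \<open>P\<close> cause no trouble
    for any derivation that respects \<open>P\<close> on \<open>S\<close>.\<close>
  have coeffs_in_P: "E (poly p X) \<in> P \<and> poly p X \<in> P"
    if "derivation E" "\<And>a. a \<in> S \<Longrightarrow> a \<in> P \<Longrightarrow> E a \<in> P" "?S p" "\<forall>i. coeff p i \<in> P" for E p
  proof -
    interpret E: derivation E by fact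
    show ?thesis
      using that(3,4)
    proof (induction p)
      case (pCons c p)
      then show ?case using that(2)
        by (auto simp: coeffs_pCons_iff E.add E.mult intro!: P.add P.mult P.mult_right[of "poly p X"])
    qed (auto simp: E.zero P.zero)
  qed
  show ?thesis
  proof (cases "X \<in> P")
    case True
    \<comment> \<open>Modulo \<open>P\<close> only the constant coefficient matters: the other terms
      are multiples of \<open>X\<close>, and remain so under \<open>D\<close> because
      \<open>D X = 0\<close>.\<close>
    have "D (poly p X) \<in> P" if "?S p" "poly p X \<in> P" for p
      using that
    proof (cases p)
      case (pCons c r)
      then have "c + X * poly r X \<in> P" "c \<in> S" using that by (auto simp: coeffs_pCons_iff)
      moreover from this(1) have "c \<in> P" by (rule P.add_cancel_right) (use True P.mult_right in auto)
      ultimately show ?thesis using True DP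
        by (auto simp: pCons D.add D.mult DX intro!: P.add P.mult_right)
    qed
    then show ?thesis
      using P.one_notin by (intro exI[of _ 1] exI[of _ 0]) (auto simp: adjoin_def)
  next
    case XP: False
    show ?thesis
    proof (cases "\<forall>p. ?S p \<longrightarrow> poly p X \<in> P \<longrightarrow> (\<forall>i. coeff p i \<in> P)")
      case True
      then show ?thesis
        using P.one_notin coeffs_in_P[OF D DP]
        by (intro exI[of _ 1] exI[of _ 0]) (auto simp: adjoin_def)
    next
      case False
      \<comment> \<open>A bad polynomial is a nontrivial algebraic relation for \<open>X\<close>
        modulo \<open>P\<close>. One of least degree, \<open>G\<close>, is a minimal polynomial up
        to denominators.\<close>
      define bad where "bad p \<longleftrightarrow> ?S p \<and> poly p X \<in> P \<and> \<not> (\<forall>i. coeff p i \<in> P)" for p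
      obtain p0 where "bad p0" using False by (auto simp: bad_def)
      define G where "G = arg_min degree bad"
      have G: "bad G" and min: "\<And>p. bad p \<Longrightarrow> degree G \<le> degree p"
        unfolding G_def using arg_min_nat_lemma[of bad p0 degree] \<open>bad p0\<close> by auto
      let ?e = "degree G"
      let ?c = "coeff G ?e"
      have small: "\<forall>i. coeff p i \<in> P" if "?S p" "poly p X \<in> P" "degree p < ?e" for p
        using min[of p] that by (auto simp: bad_def)
      \<comment> \<open>Otherwise dropping the leading term would leave a bad polynomial of smaller
        degree.\<close>
      have lcP: "?c \<notin> P"
      proof
        assume c: "?c \<in> P"
        let ?r = "G - monom ?c ?e"
        have "poly ?r X \<in> P" using G c by (auto simp: bad_def poly_monom intro!: P.diff P.mult_right)
        moreover have "?S ?r" using G by (auto simp: bad_def intro: S.zero)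
        moreover obtain i where i: "coeff G i \<notin> P" using G by (auto simp: bad_def)
        then have "i \<noteq> ?e" using c by auto
        then have "coeff ?r i \<notin> P" using i by auto
        ultimately have "bad ?r" unfolding bad_def by blast
        then have le: "?e \<le> degree ?r" by (rule min)
        have "i < ?e" using i \<open>i \<noteq> ?e\<close> P.zero le_degree[of G i] by fastforce
        moreover have "degree ?r \<le> ?e" by (rule degree_diff_le) (auto intro: degree_monom_le)
        ultimately have "degree ?r = ?e" "?e > 0" using le by auto
        moreover have "coeff ?r ?e = 0" by simp
        ultimately show False using leading_coeff_0_iff[of ?r] by force
      qed
      have e0: "?e > 0"
      proof (rule ccontr)
        assume "\<not> ?e > 0"
        then obtain c where "G = [:c:]" by (metis degree_eq_zeroE gr0I)
        then show False using G lcP by (auto simp: bad_def)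
      qed
      have \<theta>_poly: "\<theta> (poly p X) = X * poly (pderiv p) X" if "?S p" for p
        using that
      proof (induction p)
        case (pCons c p)
        then show ?case
          by (auto simp: coeffs_pCons_iff \<theta>.add \<theta>.mult \<theta>S \<theta>X pderiv_pCons algebra_simps)
      qed (simp add: \<theta>.zero)
      \<comment> \<open>chosen so that \<open>q D + y \<theta>\<close> annihilates \<open>g = G(X)\<close>; then pseudo-division by \<open>G\<close> reduces
        every other element of \<open>P \<inter> S[X]\<close> to one with coefficients in \<open>P\<close>\<close>
      define q where "q = \<theta> (poly G X)"
      define y where "y = - D (poly G X)"
      \<comment> \<open>Separability: the derivative has smaller degree than \<open>G\<close>, and
        its leading coefficient \<open>of_nat ?e * ?c\<close> is outside \<open>P\<close>. By
        minimality of \<open>G\<close>, its value at \<open>X\<close> is outside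
        \<open>P\<close>.\<close>
      have "?S (pderiv G)" using G by (auto simp: bad_def coeff_pderiv simp del: of_nat_Suc intro!: S.mult S.of_nat)
      moreover have "degree (pderiv G) < ?e"
      proof -
        have "degree (pderiv G) \<le> ?e - 1"
          by (rule degree_le) (auto simp: coeff_pderiv coeff_eq_0)
        then show ?thesis using e0 by simp
      qed
      moreover have "coeff (pderiv G) (?e - 1) \<notin> P"
        using e0 lcP char[of ?e] P.prime by (auto simp: coeff_pderiv simp del: of_nat_Suc)
      ultimately have "poly (pderiv G) X \<notin> P" using small by blast
      then have qP: "q \<notin> P" unfolding q_def using \<theta>_poly[of G] G XP P.prime by (auto simp: bad_def)
      define E where "E a = q * D a + y * \<theta> a" for a
      have "derivation E" unfolding E_def by (intro derivation_plus derivation_smult D \<theta>)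
      then interpret E: derivation E .
      have ES: "E a \<in> P" if "a \<in> S" "a \<in> P" for a
        using that by (auto simp: E_def \<theta>S intro!: P.mult DP)
      have EG: "E (poly G X) = 0" by (simp add: E_def q_def y_def algebra_simps)
      have "E (poly p X) \<in> P" if "?S p" "poly p X \<in> P" for p
        using that
      proof (induction "degree p" arbitrary: p rule: less_induct)
        case less
        show ?case
        proof (cases "degree p < ?e")
          case True
          then show ?thesis using small[OF less.prems] coeffs_in_P[OF E.derivation_axioms ES] less.prems by blast
        next
          case False
          let ?m = "monom (coeff p (degree p)) (degree p - ?e)"
          \<comment> \<open>Multiplying \<open>p\<close> by \<open>?c\<close> replaces division by
            the leading coefficient of \<open>G\<close>; the factor is cancelled at the end because
            \<open>?c \<notin> P\<close>.\<close>
          let ?r = "smult ?c p - ?m * G"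
          have Sm: "?S ?m" using less.prems S.zero by auto
          have SG: "?S G" "poly G X \<in> P" using G by (auto simp: bad_def)
          have "?S ?r" using less.prems SG Sm
            by (auto intro!: S.diff S.mult S.coeff_mult)
          moreover have "poly ?r X \<in> P"
            using less.prems SG by (auto intro!: P.diff P.mult)
          moreover have "degree ?r < degree p"
          proof -
            have "degree ?r \<le> degree p"
            proof (rule degree_diff_le)
              show "degree (?m * G) \<le> degree p"
                using degree_mult_le[of ?m G] degree_monom_le[of "coeff p (degree p)" "degree p - ?e"] False by linarith
            qed (rule degree_smult_le)
            moreover have "coeff ?r (degree p) = 0"
            proof -
              have "coeff (?m * G) (degree p) = coeff p (degree p) * ?c"
                using False by (simp add: coeff_monom_mult)
              then show ?thesis by (simp only: coeff_diff coeff_smult mult.commute[of ?c] diff_self)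
            qed
            ultimately show ?thesis
              using False e0 leading_coeff_0_iff[of ?r] by (cases "degree ?r = degree p") auto
          qed
          ultimately have "E (poly ?r X) \<in> P" by (rule less.hyps[rotated 1])
          moreover have "E (poly ?r X) = ?c * E (poly p X) + (poly p X * E ?c - poly G X * E (poly ?m X))"
            by (simp add: E.diff E.mult EG)
          moreover have "poly p X * E ?c - poly G X * E (poly ?m X) \<in> P"
            using less.prems SG by (intro P.diff P.mult_right)
          ultimately have "?c * E (poly p X) \<in> P" using P.add_cancel_right by metis
          then show ?thesis using lcP P.prime by blast
        qed
      qed
      then show ?thesis using qP by (intro exI[of _ q] exI[of _ y]) (auto simp: adjoin_def E_def)
    qed
  qed
qed

section \<open>Towers of adjunctions\<close>

fun adjoin_upto :: "'a::comm_ring_1 set \<Rightarrow> (nat \<Rightarrow> 'a) \<Rightarrow> nat \<Rightarrow> 'a set" where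
  "adjoin_upto S x 0 = S"
| "adjoin_upto S x (Suc n) = adjoin (adjoin_upto S x n) (x n)"

lemma subring_adjoin_upto: "subring_set S \<Longrightarrow> subring_set (adjoin_upto S x n)"
  by (induction n) (auto intro: subring_set.subring_adjoin)

lemma subset_adjoin_upto: "subring_set S \<Longrightarrow> S \<subseteq> adjoin_upto S x n"
proof (induction n)
  case (Suc n)
  then show ?case
    using subring_set.subset_adjoin[OF subring_adjoin_upto[OF Suc.prems, of x n], of "x n"] by auto
qed simp

lemma generator_in_adjoin_upto: "subring_set S \<Longrightarrow> i < n \<Longrightarrow> x i \<in> adjoin_upto S x n"
proof (induction n)
  case (Suc n)
  interpret S: subring_set "adjoin_upto S x n" by (rule subring_adjoin_upto) fact
  show ?case
    using Suc S.subset_adjoin[of "x n"] S.generator_in_adjoin[of "x n"] by (auto simp: less_Suc_eq)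
qed simp

lemma derivation_zero_on_adjoin_upto:
  assumes "derivation D" "\<And>a. a \<in> S \<Longrightarrow> D a = 0" "\<And>i. i < n \<Longrightarrow> D (x i) = 0" "a \<in> adjoin_upto S x n"
  shows "D a = 0"
  using assms(3,4)
proof (induction n arbitrary: a)
  case (Suc n)
  show ?case
    by (rule derivation_zero_on_adjoin[of D "adjoin_upto S x n" "x n"]) (use Suc assms(1) in auto)
qed (use assms in auto)

text \<open>One generator is treated at a time. The derivation built so far kills the next
  generator, and \<open>\<theta> n\<close> kills the ring built so far, so
  \<open>derivation_extend\<close> applies; each step rescales the earlier multipliers by an element
  outside \<open>P\<close>.\<close>

lemma derivation_extend_upto:
  fixes W :: "'a::idom \<Rightarrow> 'a" and \<theta> :: "nat \<Rightarrow> 'a \<Rightarrow> 'a"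
  assumes P: "prime_ring_ideal P" and char: "\<And>e. e > 0 \<Longrightarrow> of_nat e \<notin> P"
    and S: "subring_set S" and W: "derivation W" and \<theta>: "\<And>i. derivation (\<theta> i)"
    and \<theta>S: "\<And>i a. a \<in> S \<Longrightarrow> \<theta> i a = 0" and \<theta>x: "\<And>i j. \<theta> i (x j) = (if i = j then x j else 0)"
    and Wx: "\<And>i. W (x i) = 0" and WP: "\<And>a. a \<in> S \<Longrightarrow> a \<in> P \<Longrightarrow> W a \<in> P"
  shows "\<exists>q l. q \<notin> P \<and> (\<forall>a\<in>adjoin_upto S x n. a \<in> P \<longrightarrow> q * W a + (\<Sum>i<n. l i * \<theta> i a) \<in> P)"
proof (induction n)
  case 0
  then show ?case using WP prime_ring_ideal.one_notin[OF P] by (auto intro!: exI[of _ 1])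
next
  case (Suc n)
  interpret P: prime_ring_ideal P by fact
  obtain q l where q: "q \<notin> P"
    and l: "\<And>a. a \<in> adjoin_upto S x n \<Longrightarrow> a \<in> P \<Longrightarrow> q * W a + (\<Sum>i<n. l i * \<theta> i a) \<in> P"
    using Suc by blast
  define D where "D a = q * W a + (\<Sum>i<n. l i * \<theta> i a)" for a
  have D: "derivation D"
    unfolding D_def by (intro derivation_plus derivation_smult derivation_sum W \<theta>)
  have "\<exists>r y. r \<notin> P \<and> (\<forall>a\<in>adjoin (adjoin_upto S x n) (x n). a \<in> P \<longrightarrow> r * D a + y * \<theta> n a \<in> P)"
  proof (rule derivation_extend[OF P char subring_adjoin_upto[OF S] D \<theta>])
    show "\<theta> n a = 0" if "a \<in> adjoin_upto S x n" for a
      by (rule derivation_zero_on_adjoin_upto[OF \<theta>, of S n n x]) (use that \<theta>S \<theta>x in auto)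
    show "D (x n) = 0" by (auto simp: D_def Wx \<theta>x)
  qed (use l \<theta>x in \<open>auto simp: D_def\<close>)
  then obtain r y where r: "r \<notin> P"
    and y: "\<And>a. a \<in> adjoin (adjoin_upto S x n) (x n) \<Longrightarrow> a \<in> P \<Longrightarrow> r * D a + y * \<theta> n a \<in> P" by blast
  have eq: "r * D a + y * \<theta> n a = (r * q) * W a + (\<Sum>i<Suc n. ((\<lambda>i. r * l i)(n := y)) i * \<theta> i a)" for a
    by (simp add: D_def algebra_simps sum_distrib_left)
  show ?case
    by (rule exI[of _ "r * q"], rule exI[of _ "(\<lambda>i. r * l i)(n := y)"])
      (use y r q P.prime in \<open>auto simp only: eq adjoin_upto.simps\<close>)
qed

section \<open>Determinants with permuted columns\<close>

text \<open>Multiplying \<open>M v\<close> by the adjugate expresses \<open>det M * v r\<close> as a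
  combination of elements of \<open>P\<close>; primality removes the factor
  \<open>v r\<close>.\<close>

lemma det_in_prime_if_kernel:
  fixes M :: "nat \<Rightarrow> nat \<Rightarrow> 'a::comm_ring_1"
  assumes P: "prime_ring_ideal P"
    and ker: "\<And>j. j < n \<Longrightarrow> (\<Sum>i<n. M j i * v i) \<in> P"
    and v: "r < n" "v r \<notin> P"
  shows "det (mat n n (\<lambda>(j, i). M j i)) \<in> P"
proof -
  interpret P: prime_ring_ideal P by fact
  define A where "A = mat n n (\<lambda>(j, i). M j i)"
  have A: "A \<in> carrier_mat n n" by (simp add: A_def)
  note adj = adj_mat[OF A]
  have entry: "(\<Sum>j<n. adj_mat A $$ (r, j) * M j i) = (if r = i then det A else 0)" if "i < n" for i
  proof -
    have "(adj_mat A * A) $$ (r, i) = (\<Sum>j<n. adj_mat A $$ (r, j) * M j i)"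
      using adj(1) A that v(1) by (simp add: scalar_prod_def A_def lessThan_atLeast0)
    then show ?thesis using adj(3) that v(1) by (cases "r = i") auto
  qed
  have "det A * v r = (\<Sum>i<n. (if r = i then det A else 0) * v i)"
    using v(1) by (simp add: if_distrib[of "\<lambda>x. x * _"] cong: if_cong)
  also have "\<dots> = (\<Sum>i<n. (\<Sum>j<n. adj_mat A $$ (r, j) * M j i) * v i)"
    by (rule sum.cong) (simp_all add: entry)
  also have "\<dots> = (\<Sum>i<n. \<Sum>j<n. adj_mat A $$ (r, j) * (M j i * v i))"
    by (simp add: sum_distrib_right mult.assoc)
  also have "\<dots> = (\<Sum>j<n. \<Sum>i<n. adj_mat A $$ (r, j) * (M j i * v i))"
    by (rule sum.swap)
  also have "\<dots> = (\<Sum>j<n. adj_mat A $$ (r, j) * (\<Sum>i<n. M j i * v i))"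
    by (simp add: sum_distrib_left)
  also have "\<dots> \<in> P" by (intro P.sum P.mult ker) simp
  finally show ?thesis using P.prime v(2) by (auto simp: A_def)
qed

section \<open>Sums over the symmetric group\<close>

lemma sum_sign_permutes:
  assumes "finite U" "a \<in> U" "b \<in> U" "a \<noteq> b"
  shows "(\<Sum>p | p permutes U. sign p) = 0"
proof -
  let ?t = "transpose a b"
  have t: "?t permutes U" using assms by (auto intro: permutes_swap_id)
  have "(\<Sum>p | p permutes U. sign p) = (\<Sum>p | p permutes U. sign (?t \<circ> p))"
    by (rule setum_permutations_compose_left[OF t])
  also have "\<dots> = (\<Sum>p | p permutes U. - sign p)"
  proof (rule sum.cong)
    fix p assume "p \<in> {p. p permutes U}"
    then have "permutation p" "permutation ?t"
      using assms(1) t permutation_permutes by blast+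
    then show "sign (?t \<circ> p) = - sign p" using assms(4) by (simp add: sign_compose sign_swap_id)
  qed simp
  finally show ?thesis by (simp add: sum_negf)
qed

text \<open>All values \<open>\<tau> i\<close> occur equally often: composing with a transposition
  matches the permutations that send \<open>i\<close> to \<open>j\<close> with those that fix
  \<open>i\<close>.\<close>

lemma sum_permutes_apply:
  fixes g :: "'b \<Rightarrow> 'a::comm_ring_1"
  assumes U: "finite U" "i \<in> U"
  shows "(\<Sum>\<tau> | \<tau> permutes U. g (\<tau> i)) = of_nat (card {\<tau>. \<tau> permutes U \<and> \<tau> i = i}) * (\<Sum>j\<in>U. g j)"
proof -
  have card: "card {\<tau>. \<tau> permutes U \<and> \<tau> i = j} = card {\<tau>. \<tau> permutes U \<and> \<tau> i = i}" if "j \<in> U" for j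
  proof (rule bij_betw_same_card)
    let ?t = "transpose i j"
    have t: "?t permutes U" using U that by (auto intro: permutes_swap_id)
    have tt: "?t \<circ> (?t \<circ> p) = p" for p by (simp add: comp_assoc[symmetric])
    show "bij_betw (\<lambda>p. ?t \<circ> p) {\<tau>. \<tau> permutes U \<and> \<tau> i = j} {\<tau>. \<tau> permutes U \<and> \<tau> i = i}"
      by (rule bij_betwI[where g = "\<lambda>p. ?t \<circ> p"]) (use t in \<open>auto simp: tt intro: permutes_compose\<close>)
  qed
  have "(\<Sum>\<tau> | \<tau> permutes U. g (\<tau> i)) = (\<Sum>j\<in>U. \<Sum>\<tau> | \<tau> \<in> {\<tau>. \<tau> permutes U} \<and> \<tau> i = j. g (\<tau> i))"
    by (rule sum.group[symmetric]) (use U in \<open>auto simp: finite_permutations permutes_in_image\<close>)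
  also have "\<dots> = (\<Sum>j\<in>U. \<Sum>\<tau> | \<tau> permutes U \<and> \<tau> i = j. g j)"
    by (intro sum.cong) auto
  also have "\<dots> = (\<Sum>j\<in>U. of_nat (card {\<tau>. \<tau> permutes U \<and> \<tau> i = i}) * g j)"
    by (intro sum.cong) (auto simp: card)
  finally show ?thesis by (simp add: sum_distrib_left)
qed

text \<open>The product restricts the sum to permutations of the complement of \<open>T\<close>.
  Their signs cancel as soon as the complement has two elements; otherwise only the identity is
  left.\<close>

lemma sum_sign_fixing:
  assumes "T \<subseteq> {..<n::nat}"
  shows "(\<Sum>p | p permutes {..<n}. sign p * (\<Prod>i\<in>T. if p i = i then 1 else 0)) =
    (if card ({..<n} - T) \<le> 1 then 1 else 0)"
proof -
  let ?U = "{..<n} - T"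
  have fin: "finite T" using assms finite_subset by blast
  have sub: "{p. p permutes ?U} = {p \<in> {p. p permutes {..<n}}. \<forall>i\<in>T. p i = i}" (is "?A = ?B")
  proof
    show "?A \<subseteq> ?B"
      using permutes_subset[of _ ?U "{..<n}"] permutes_not_in[of _ ?U] by blast
    show "?B \<subseteq> ?A"
    proof
      fix p assume "p \<in> ?B"
      then have "p permutes ?U" using permutes_superset[of p "{..<n}" ?U] by auto
      then show "p \<in> ?A" by simp
    qed
  qed
  have "(\<Sum>p | p permutes {..<n}. sign p * (\<Prod>i\<in>T. if p i = i then 1 else 0)) =
     (\<Sum>p | p permutes {..<n}. if \<forall>i\<in>T. p i = i then sign p else 0)"
  proof (rule sum.cong[OF refl])
    fix p
    show "sign p * (\<Prod>i\<in>T. if p i = i then 1 else 0) = (if \<forall>i\<in>T. p i = i then sign p else 0)"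
    proof (cases "\<forall>i\<in>T. p i = i")
      case False
      then have "(\<Prod>i\<in>T. if p i = i then 1 else 0) = (0::int)" using fin by (auto intro: prod_zero)
      then show ?thesis using False by simp
    qed simp
  qed
  also have "\<dots> = (\<Sum>p\<in>?B. sign p)"
    by (rule sum.inter_filter[symmetric]) (simp add: finite_permutations)
  also have "\<dots> = (\<Sum>p | p permutes ?U. sign p)" by (simp only: sub)
  also have "\<dots> = (if card ?U \<le> 1 then 1 else 0)"
  proof (cases "card ?U \<le> 1")
    case True
    then have "?U = {} \<or> (\<exists>a. ?U = {a})"
      by (metis One_nat_def card_0_eq card_1_singletonE finite_Diff finite_lessThan le_Suc_eq le_zero_eq)
    then have "{p. p permutes ?U} = {id}"
      by (elim disjE exE; simp only: permutes_empty permutes_sing singleton_conv)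
    then show ?thesis using True by (simp add: sign_id)
  next
    case False
    then obtain a b where "a \<in> ?U" "b \<in> ?U" "a \<noteq> b"
      using card_le_Suc0_iff_eq[of ?U] by auto
    then show ?thesis using False sum_sign_permutes[of ?U a b] by simp
  qed
  finally show ?thesis .
qed

text \<open>Once the determinants are expanded and \<open>\<tau> = \<sigma> \<circ> p\<close> is
  substituted, \<open>p\<close> enters only through its sign and the diagonal, and
  \<open>\<tau>\<close> only through \<open>B\<close>. Summing over \<open>p\<close> kills every
  choice of two or more factors from \<open>B\<close>; a single factor from \<open>B\<close> sums to
  zero over \<open>\<tau>\<close>, because the rows of \<open>B\<close> do. The pure diagonal
  product remains, once for each \<open>\<tau>\<close>.\<close>

lemma sum_det_column_permutations:
  fixes a :: "nat \<Rightarrow> 'a::comm_ring_1" and B :: "nat \<Rightarrow> nat \<Rightarrow> 'a"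
  assumes B: "\<And>j. j < n \<Longrightarrow> (\<Sum>i<n. B j i) = 0"
  shows "(\<Sum>\<sigma> | \<sigma> permutes {..<n}. det (mat n n (\<lambda>(j, i). (if j = i then a j else 0) + B j (\<sigma> i))))
    = of_nat (fact n) * (\<Prod>j<n. a j)"
proof -
  let ?S = "{p. p permutes {..<n}}"
  let ?f = "\<lambda>p i. (if p i = i then 1 else 0) * a i"
  have "(\<Sum>\<sigma>\<in>?S. det (mat n n (\<lambda>(j, i). (if j = i then a j else 0) + B j (\<sigma> i)))) =
     (\<Sum>\<sigma>\<in>?S. \<Sum>p\<in>?S. of_int (sign p) * (\<Prod>i<n. ?f p i + B i ((\<sigma> \<circ> p) i)))"
  proof (rule sum.cong[OF refl])
    fix \<sigma>
    show "det (mat n n (\<lambda>(j, i). (if j = i then a j else 0) + B j (\<sigma> i))) =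
      (\<Sum>p\<in>?S. of_int (sign p) * (\<Prod>i<n. ?f p i + B i ((\<sigma> \<circ> p) i)))"
      unfolding det_def'[OF mat_carrier] lessThan_atLeast0
    proof (intro sum.cong refl arg_cong2[of _ _ _ _ "(*)"] prod.cong)
      fix p i assume "p \<in> {p. p permutes {0..<n}}" "i \<in> {0..<n}"
      then have "p i < n" by (metis atLeastLessThan_iff mem_Collect_eq permutes_in_image)
      then show "mat n n (\<lambda>(j, i). (if j = i then a j else 0) + B j (\<sigma> i)) $$ (i, p i) =
          ?f p i + B i ((\<sigma> \<circ> p) i)"
        using \<open>i \<in> {0..<n}\<close> by auto
    qed
  qed
  also have "\<dots> = (\<Sum>p\<in>?S. \<Sum>\<sigma>\<in>?S. of_int (sign p) * (\<Prod>i<n. ?f p i + B i ((\<sigma> \<circ> p) i)))"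
    by (rule sum.swap)
  \<comment> \<open>For fixed \<open>p\<close>, composition with \<open>p\<close> is a bijection of
    the symmetric group; this decouples \<open>B\<close> from \<open>p\<close>.\<close>
  also have "\<dots> = (\<Sum>p\<in>?S. \<Sum>\<tau>\<in>?S. of_int (sign p) * (\<Prod>i<n. ?f p i + B i (\<tau> i)))"
  proof (rule sum.cong[OF refl])
    fix p assume "p \<in> ?S"
    then have p: "p permutes {..<n}" by simp
    show "(\<Sum>\<sigma>\<in>?S. of_int (sign p) * (\<Prod>i<n. ?f p i + B i ((\<sigma> \<circ> p) i))) =
      (\<Sum>\<tau>\<in>?S. of_int (sign p) * (\<Prod>i<n. ?f p i + B i (\<tau> i)))"
      by (rule sum_permutations_compose_right[OF p, symmetric])
  qed
  \<comment> \<open>\<open>T\<close> is the set of rows in which the diagonal summand is taken when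
    the product is multiplied out.\<close>
  also have "\<dots> = (\<Sum>p\<in>?S. \<Sum>\<tau>\<in>?S. \<Sum>T\<in>Pow {..<n}.
      of_int (sign p * (\<Prod>i\<in>T. if p i = i then 1 else 0)) * ((\<Prod>i\<in>T. a i) * (\<Prod>i\<in>{..<n}-T. B i (\<tau> i))))"
    by (intro sum.cong refl)
      (simp add: prod_add sum_distrib_left prod.distrib of_int_prod if_distrib[of of_int] mult.assoc cong: if_cong)
  also have "\<dots> = (\<Sum>p\<in>?S. \<Sum>T\<in>Pow {..<n}. \<Sum>\<tau>\<in>?S.
      of_int (sign p * (\<Prod>i\<in>T. if p i = i then 1 else 0)) * ((\<Prod>i\<in>T. a i) * (\<Prod>i\<in>{..<n}-T. B i (\<tau> i))))"
    by (intro sum.cong refl sum.swap)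
  also have "\<dots> = (\<Sum>T\<in>Pow {..<n}. \<Sum>p\<in>?S. \<Sum>\<tau>\<in>?S.
      of_int (sign p * (\<Prod>i\<in>T. if p i = i then 1 else 0)) * ((\<Prod>i\<in>T. a i) * (\<Prod>i\<in>{..<n}-T. B i (\<tau> i))))"
    by (rule sum.swap)
  also have "\<dots> = (\<Sum>T\<in>Pow {..<n}. of_int (\<Sum>p\<in>?S. sign p * (\<Prod>i\<in>T. if p i = i then 1 else 0)) *
      ((\<Prod>i\<in>T. a i) * (\<Sum>\<tau>\<in>?S. \<Prod>i\<in>{..<n}-T. B i (\<tau> i))))"
  proof (rule sum.cong[OF refl])
    fix T
    show "(\<Sum>p\<in>?S. \<Sum>\<tau>\<in>?S. of_int (sign p * (\<Prod>i\<in>T. if p i = i then 1 else 0)) *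
        ((\<Prod>i\<in>T. a i) * (\<Prod>i\<in>{..<n}-T. B i (\<tau> i)))) =
      of_int (\<Sum>p\<in>?S. sign p * (\<Prod>i\<in>T. if p i = i then 1 else 0)) *
        ((\<Prod>i\<in>T. a i) * (\<Sum>\<tau>\<in>?S. \<Prod>i\<in>{..<n}-T. B i (\<tau> i)))"
      unfolding of_int_sum sum_distrib_left[of "prod a T"] sum_product ..
  qed
  also have "\<dots> = (\<Sum>T\<in>Pow {..<n}. if T = {..<n} then of_nat (fact n) * (\<Prod>j<n. a j) else 0)"
  proof (rule sum.cong[OF refl])
    fix T assume "T \<in> Pow {..<n}"
    then have T: "T \<subseteq> {..<n}" by simp
    consider "T = {..<n}" | i where "i < n" "{..<n} - T = {i}" | "card ({..<n} - T) > 1"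
    proof -
      have "card ({..<n} - T) = 0 \<or> card ({..<n} - T) = 1 \<or> card ({..<n} - T) > 1" by linarith
      then show ?thesis
      proof (elim disjE)
        assume "card ({..<n} - T) = 0"
        then show ?thesis using that(1) T by auto
      next
        assume "card ({..<n} - T) = 1"
        then obtain i where "{..<n} - T = {i}" by (auto simp: card_1_singleton_iff)
        then show ?thesis using that(2)[of i] by blast
      qed (use that in auto)
    qed
    then show "of_int (\<Sum>p\<in>?S. sign p * (\<Prod>i\<in>T. if p i = i then 1 else 0)) *
      ((\<Prod>i\<in>T. a i) * (\<Sum>\<tau>\<in>?S. \<Prod>i\<in>{..<n}-T. B i (\<tau> i))) =
      (if T = {..<n} then of_nat (fact n) * (\<Prod>j<n. a j) else 0)"
    proof cases
      case 1
      then show ?thesis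
        unfolding sum_sign_fixing[OF T] by (simp add: card_permutations[OF refl] mult.commute)
    next
      case 2
      have "(\<Sum>\<tau>\<in>?S. B i (\<tau> i)) = 0"
        using sum_permutes_apply[of "{..<n}" i "B i"] B[of i] 2 by simp
      then show ?thesis using 2 by auto
    next
      case 3
      then show ?thesis unfolding sum_sign_fixing[OF T] by auto
    qed
  qed
  also have "\<dots> = of_nat (fact n) * (\<Prod>j<n. a j)" by (subst sum.delta) auto
  finally show ?thesis .
qed

section \<open>Derivations and homomorphisms of polynomial rings\<close>

lemma poly_mapping_sum_singles:
  "p = (\<Sum>m\<in>Poly_Mapping.keys p. Poly_Mapping.single m (Poly_Mapping.lookup p m))"
proof (rule poly_mapping_eqI)
  fix k
  show "Poly_Mapping.lookup p k =
    Poly_Mapping.lookup (\<Sum>m\<in>Poly_Mapping.keys p. Poly_Mapping.single m (Poly_Mapping.lookup p m)) k"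
    by (simp add: lookup_sum lookup_single when_def in_keys_iff)
qed

lemma poly_mapping_add_induct [case_names single add]:
  fixes p :: "'m \<Rightarrow>\<^sub>0 'a::comm_monoid_add"
  assumes "\<And>m a. Q (Poly_Mapping.single m a)" "\<And>p q. Q p \<Longrightarrow> Q q \<Longrightarrow> Q (p + q)"
  shows "Q p"
proof -
  have "Q 0" using assms(1)[of undefined 0] by simp
  then have "Q (\<Sum>m\<in>J. Poly_Mapping.single m (Poly_Mapping.lookup p m))" for J
    by (induction J rule: infinite_finite_induct) (auto intro: assms)
  then show ?thesis using poly_mapping_sum_singles[of p] by metis
qed

text \<open>Both sides of the product rule are biadditive, so single terms suffice.\<close>

lemma derivation_poly_mappingI:
  fixes D :: "('m::comm_monoid_add \<Rightarrow>\<^sub>0 'a::comm_ring_1) \<Rightarrow> ('m \<Rightarrow>\<^sub>0 'a)"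
  assumes add: "\<And>p q. D (p + q) = D p + D q"
    and mult: "\<And>m a m' b. D (Poly_Mapping.single m a * Poly_Mapping.single m' b) =
      Poly_Mapping.single m a * D (Poly_Mapping.single m' b) + Poly_Mapping.single m' b * D (Poly_Mapping.single m a)"
  shows "derivation D"
proof
  fix p q
  show "D (p * q) = p * D q + q * D p"
  proof (induction p rule: poly_mapping_add_induct)
    case (single m a)
    show ?case by (induction q rule: poly_mapping_add_induct) (auto simp: mult add algebra_simps)
  qed (simp add: add algebra_simps)
qed (rule add)

text \<open>For additive \<open>w\<close> this is an Euler-type operator;
  \<open>w m = lookup m i\<close> gives \<open>x_i d/dx_i\<close>. Each monomial is an eigenvector,
  so no exponent is ever lowered.\<close>

definition weight_derivation :: "('m \<Rightarrow> nat) \<Rightarrow> ('m \<Rightarrow>\<^sub>0 'a::comm_ring_1) \<Rightarrow> ('m \<Rightarrow>\<^sub>0 'a)" where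
  "weight_derivation w p = Poly_Mapping.mapp (\<lambda>m a. of_nat (w m) * a) p"

lemma lookup_weight_derivation:
  "Poly_Mapping.lookup (weight_derivation w p) m = of_nat (w m) * Poly_Mapping.lookup p m"
  by (simp add: weight_derivation_def lookup_mapp when_def in_keys_iff)

lemma weight_derivation_single:
  "weight_derivation w (Poly_Mapping.single m a) = Poly_Mapping.single m (of_nat (w m) * a)"
  by (rule poly_mapping_eqI) (auto simp: lookup_weight_derivation lookup_single when_def)

lemma derivation_weight_derivation:
  fixes w :: "'m::comm_monoid_add \<Rightarrow> nat"
  assumes "\<And>m m'. w (m + m') = w m + w m'"
  shows "derivation (weight_derivation w :: _ \<Rightarrow> ('m \<Rightarrow>\<^sub>0 'a::comm_ring_1))"
proof (rule derivation_poly_mappingI)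
  show "weight_derivation w (p + q) = weight_derivation w p + weight_derivation w q"
    for p q :: "'m \<Rightarrow>\<^sub>0 'a"
    by (rule poly_mapping_eqI) (simp add: lookup_weight_derivation lookup_add algebra_simps)
qed (simp add: weight_derivation_single mult_single assms algebra_simps single_add[symmetric])

text \<open>Lifts a derivation of the coefficient ring, with the polynomial variables held
  constant.\<close>

definition coeff_derivation :: "('a::comm_ring_1 \<Rightarrow> 'a) \<Rightarrow> ('m \<Rightarrow>\<^sub>0 'a) \<Rightarrow> ('m \<Rightarrow>\<^sub>0 'a)" where
  "coeff_derivation d = Poly_Mapping.map d"

lemma coeff_derivation_single:
  "derivation d \<Longrightarrow> coeff_derivation d (Poly_Mapping.single m a) = Poly_Mapping.single m (d a)"
  by (simp add: coeff_derivation_def derivation.zero)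

lemma derivation_coeff_derivation:
  assumes "derivation d"
  shows "derivation (coeff_derivation d :: ('m::comm_monoid_add \<Rightarrow>\<^sub>0 'a::comm_ring_1) \<Rightarrow> _)"
proof (rule derivation_poly_mappingI)
  interpret derivation d by fact
  have lookup: "Poly_Mapping.lookup (coeff_derivation d p) m = d (Poly_Mapping.lookup p m)"
    for p :: "'m \<Rightarrow>\<^sub>0 'a" and m
    by (simp add: coeff_derivation_def Poly_Mapping.map.rep_eq when_def zero)
  show "coeff_derivation d (p + q) = coeff_derivation d p + coeff_derivation d q"
    for p q :: "'m \<Rightarrow>\<^sub>0 'a"
    by (rule poly_mapping_eqI) (simp add: lookup lookup_add add)
  show "coeff_derivation d (Poly_Mapping.single m a * Poly_Mapping.single m' b) =
      Poly_Mapping.single m a * coeff_derivation d (Poly_Mapping.single m' b) +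
      Poly_Mapping.single m' b * coeff_derivation d (Poly_Mapping.single m a)" for m m' :: 'm and a b
    by (simp add: coeff_derivation_single[OF assms] mult_single mult single_add add.commute[of m])
qed

section \<open>Substitution homomorphisms\<close>

definition mono_eval :: "('v \<Rightarrow> 'b::comm_semiring_1) \<Rightarrow> ('v \<Rightarrow>\<^sub>0 nat) \<Rightarrow> 'b" where
  "mono_eval x m = (\<Prod>v\<in>Poly_Mapping.keys m. x v ^ Poly_Mapping.lookup m v)"

lemma mono_eval_superset:
  assumes "finite V" "Poly_Mapping.keys m \<subseteq> V"
  shows "mono_eval x m = (\<Prod>v\<in>V. x v ^ Poly_Mapping.lookup m v)"
  unfolding mono_eval_def
  by (rule prod.mono_neutral_left) (use assms in \<open>auto simp: in_keys_iff\<close>)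

lemma mono_eval_add: "mono_eval x (m + m') = mono_eval x m * mono_eval x m'"
proof -
  let ?V = "Poly_Mapping.keys m \<union> Poly_Mapping.keys m'"
  have "mono_eval x (m + m') = (\<Prod>v\<in>?V. x v ^ Poly_Mapping.lookup (m + m') v)"
    by (rule mono_eval_superset) (auto dest: keys_add[THEN subsetD])
  also have "\<dots> = (\<Prod>v\<in>?V. x v ^ Poly_Mapping.lookup m v) * (\<Prod>v\<in>?V. x v ^ Poly_Mapping.lookup m' v)"
    by (simp add: lookup_add power_add prod.distrib)
  also have "\<dots> = mono_eval x m * mono_eval x m'"
    by (simp add: mono_eval_superset[of ?V])
  finally show ?thesis .
qed

text \<open>For a homomorphism \<open>\<phi>\<close> this is its extension that sends variables to
  \<open>x\<close>. Evaluation, the action of permutations, setting variables to zero and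
  specialising coefficients are all instances.\<close>

definition poly_hom :: "('a::comm_ring_1 \<Rightarrow> 'b::comm_ring_1) \<Rightarrow> ('v \<Rightarrow> 'b) \<Rightarrow> (('v \<Rightarrow>\<^sub>0 nat) \<Rightarrow>\<^sub>0 'a) \<Rightarrow> 'b" where
  "poly_hom \<phi> x p = (\<Sum>m\<in>Poly_Mapping.keys p. \<phi> (Poly_Mapping.lookup p m) * mono_eval x m)"

lemma poly_hom_single:
  assumes "comm_ring_hom \<phi>"
  shows "poly_hom \<phi> x (Poly_Mapping.single m a) = \<phi> a * mono_eval x m"
proof -
  interpret comm_ring_hom \<phi> by fact
  show ?thesis by (simp add: poly_hom_def)
qed

lemma comm_ring_hom_poly_hom:
  assumes "comm_ring_hom \<phi>"
  shows "comm_ring_hom (poly_hom \<phi> x)"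
proof -
  interpret comm_ring_hom \<phi> by fact
  have add: "poly_hom \<phi> x (p + q) = poly_hom \<phi> x p + poly_hom \<phi> x q" for p q
    unfolding poly_hom_def
    by (rule setsum_keys_plus_distrib) (auto simp: hom_distribs algebra_simps)
  have "poly_hom \<phi> x (p * q) = poly_hom \<phi> x p * poly_hom \<phi> x q" for p q
  proof (induction p rule: poly_mapping_add_induct)
    case (single m a)
    show ?case
      by (induction q rule: poly_mapping_add_induct)
        (auto simp: add algebra_simps mult_single poly_hom_single[OF assms] mono_eval_add hom_distribs)
  qed (simp add: add algebra_simps)
  moreover have "poly_hom \<phi> x 1 = 1"
    using poly_hom_single[OF assms, of x 0 1] by (simp add: mono_eval_def)
  moreover have "poly_hom \<phi> x 0 = 0" by (simp add: poly_hom_def)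
  ultimately show ?thesis
    by unfold_locales (auto simp: add)
qed

lemma eval_poly_conv_poly_hom: "eval_poly P c = poly_hom (\<lambda>a. a) c P"
  by (simp add: eval_poly_def poly_hom_def mono_eval_def)

lemma comm_ring_hom_single: "comm_ring_hom (Poly_Mapping.single (0::'m::comm_monoid_add))"
  by unfold_locales (auto simp: single_add mult_single)

definition var :: "'v \<Rightarrow> ('v \<Rightarrow>\<^sub>0 nat) \<Rightarrow>\<^sub>0 'a::comm_ring_1" where
  "var v = Poly_Mapping.single (Poly_Mapping.single v 1) 1"

lemma prod_single: "(\<Prod>i\<in>J. Poly_Mapping.single (f i) (1::'a::comm_ring_1)) = Poly_Mapping.single (sum f J) 1"
  by (induction J rule: infinite_finite_induct) (auto simp: mult_single)

lemma var_power: "var v ^ e = Poly_Mapping.single (Poly_Mapping.single v e) (1::'a::comm_ring_1)"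
  by (induction e) (auto simp: var_def mult_single single_add[symmetric])

lemma mono_eval_var_comp:
  "mono_eval (\<lambda>v. var (s v)) m =
    Poly_Mapping.single (\<Sum>v\<in>Poly_Mapping.keys m. Poly_Mapping.single (s v) (Poly_Mapping.lookup m v)) (1::'a::comm_ring_1)"
  by (simp add: mono_eval_def var_power prod_single)

lemma mono_eval_var: "mono_eval var m = Poly_Mapping.single m (1::'a::comm_ring_1)"
  using mono_eval_var_comp[of "\<lambda>v. v" m] by (simp flip: poly_mapping_sum_singles)

section \<open>The action of permutations as a substitution\<close>

lemma lookup_perm_exp:
  assumes "bij \<sigma>"
  shows "Poly_Mapping.lookup (perm_exp \<sigma> \<alpha>) i = Poly_Mapping.lookup \<alpha> (inv_into UNIV \<sigma> i)"
  using assms by (simp add: perm_exp_def map_key.rep_eq bij_is_inj bij_imp_bij_inv)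

lemma keys_perm_exp:
  assumes "bij \<sigma>"
  shows "Poly_Mapping.keys (perm_exp \<sigma> \<alpha>) = \<sigma> ` Poly_Mapping.keys \<alpha>"
proof (rule Set.set_eqI)
  fix i
  have "i \<in> Poly_Mapping.keys (perm_exp \<sigma> \<alpha>) \<longleftrightarrow> inv_into UNIV \<sigma> i \<in> Poly_Mapping.keys \<alpha>"
    by (simp add: in_keys_iff lookup_perm_exp[OF assms])
  moreover have "\<sigma> (inv_into UNIV \<sigma> i) = i" "\<And>v. inv_into UNIV \<sigma> (\<sigma> v) = v"
    using assms by (simp_all add: bij_is_surj bij_is_inj surj_f_inv_f)
  ultimately show "i \<in> Poly_Mapping.keys (perm_exp \<sigma> \<alpha>) \<longleftrightarrow> i \<in> \<sigma> ` Poly_Mapping.keys \<alpha>"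
    by (auto intro: rev_image_eqI)
qed

lemma perm_exp_conv_sum:
  assumes "bij \<sigma>"
  shows "(\<Sum>v\<in>Poly_Mapping.keys \<alpha>. Poly_Mapping.single (\<sigma> v) (Poly_Mapping.lookup \<alpha> v)) = perm_exp \<sigma> \<alpha>"
proof (rule poly_mapping_eqI)
  fix i
  have "(\<Sum>v\<in>Poly_Mapping.keys \<alpha>. if \<sigma> v = i then Poly_Mapping.lookup \<alpha> v else 0) =
    (\<Sum>v\<in>Poly_Mapping.keys \<alpha>. if v = inv_into UNIV \<sigma> i then Poly_Mapping.lookup \<alpha> v else 0)"
    by (rule sum.cong) (use assms in \<open>auto simp: bij_inv_eq_iff bij_is_inj\<close>)
  then show "Poly_Mapping.lookup (\<Sum>v\<in>Poly_Mapping.keys \<alpha>. Poly_Mapping.single (\<sigma> v) (Poly_Mapping.lookup \<alpha> v)) i =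
    Poly_Mapping.lookup (perm_exp \<sigma> \<alpha>) i"
    by (simp add: lookup_sum lookup_single when_def lookup_perm_exp[OF assms] in_keys_iff)
qed

lemma perm_poly_conv_poly_hom:
  assumes "bij \<sigma>"
  shows "perm_poly \<sigma> p = poly_hom (Poly_Mapping.single 0) (\<lambda>v. var (\<sigma> v)) p"
  by (simp add: perm_poly_def poly_hom_def mono_eval_var_comp perm_exp_conv_sum[OF assms] mult_single)

lemma comm_ring_hom_perm_poly: "bij \<sigma> \<Longrightarrow> comm_ring_hom (perm_poly \<sigma> :: 'k::comm_ring_1 mpoly \<Rightarrow> _)"
proof -
  assume "bij \<sigma>"
  then have "perm_poly \<sigma> = poly_hom (Poly_Mapping.single 0 :: 'k \<Rightarrow> _) (\<lambda>v. var (\<sigma> v))"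
    by (intro ext perm_poly_conv_poly_hom)
  then show ?thesis using comm_ring_hom_poly_hom[OF comm_ring_hom_single] by metis
qed

lemma perm_poly_single:
  "perm_poly \<sigma> (Poly_Mapping.single \<alpha> (a::'k::comm_ring_1)) = Poly_Mapping.single (perm_exp \<sigma> \<alpha>) a"
  by (simp add: perm_poly_def)

lemma perm_poly_of_coeffs:
  assumes "bij \<sigma>"
  shows "perm_poly \<sigma> (poly_of_coeffs A c) = (\<Sum>\<alpha>\<in>A. Poly_Mapping.single (perm_exp \<sigma> \<alpha>) (c \<alpha>))"
proof -
  interpret comm_ring_hom "perm_poly \<sigma> :: 'a mpoly \<Rightarrow> _" by (rule comm_ring_hom_perm_poly) fact
  show ?thesis by (simp add: poly_of_coeffs_def hom_sum perm_poly_single)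
qed

lemma perm_exp_comp:
  assumes "bij \<sigma>" "bij \<tau>"
  shows "perm_exp \<sigma> (perm_exp \<tau> \<alpha>) = perm_exp (\<sigma> \<circ> \<tau>) \<alpha>"
  by (rule poly_mapping_eqI) (use assms in \<open>simp add: lookup_perm_exp bij_comp o_inv_distrib\<close>)

lemma perm_poly_comp:
  assumes "bij \<sigma>" "bij \<tau>"
  shows "perm_poly \<sigma> (perm_poly \<tau> p) = perm_poly (\<sigma> \<circ> \<tau>) p"
proof -
  interpret \<sigma>: comm_ring_hom "perm_poly \<sigma> :: 'a mpoly \<Rightarrow> _" by (rule comm_ring_hom_perm_poly) fact
  interpret \<tau>: comm_ring_hom "perm_poly \<tau> :: 'a mpoly \<Rightarrow> _" by (rule comm_ring_hom_perm_poly) fact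
  interpret \<sigma>\<tau>: comm_ring_hom "perm_poly (\<sigma> \<circ> \<tau>) :: 'a mpoly \<Rightarrow> _"
    by (rule comm_ring_hom_perm_poly) (use assms bij_comp in blast)
  show ?thesis
    by (induction p rule: poly_mapping_add_induct)
      (simp_all only: \<sigma>.hom_add \<tau>.hom_add \<sigma>\<tau>.hom_add perm_poly_single perm_exp_comp[OF assms])
qed

lemma sqfree_mono_conv_prod: "sqfree_mono k = (\<Prod>i<k. var i)"
  by (simp only: sqfree_mono_def var_def prod_single)

section \<open>The generic polynomial\<close>

lemma ring_ideal_ideal_gen: "ring_ideal (ideal_gen S)"
proof
  show "0 \<in> ideal_gen S" unfolding ideal_gen_def by (auto intro!: exI[of _ "{}"])
next
  fix a b assume "a \<in> ideal_gen S" "b \<in> ideal_gen S"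
  then obtain F h F' h' where F: "finite F" "F \<subseteq> S" "a = (\<Sum>s\<in>F. h s * s)"
    and F': "finite F'" "F' \<subseteq> S" "b = (\<Sum>s\<in>F'. h' s * s)"
    unfolding ideal_gen_def by blast
  have "a = (\<Sum>s\<in>F \<union> F'. (if s \<in> F then h s else 0) * s)"
    "b = (\<Sum>s\<in>F \<union> F'. (if s \<in> F' then h' s else 0) * s)"
    unfolding F F' by (rule sum.mono_neutral_cong_left; use F F' in auto)+
  then have "a + b = (\<Sum>s\<in>F \<union> F'. ((if s \<in> F then h s else 0) + (if s \<in> F' then h' s else 0)) * s)"
    by (simp only: distrib_right sum.distrib)
  moreover have "finite (F \<union> F')" "F \<union> F' \<subseteq> S" using F F' by auto
  ultimately show "a + b \<in> ideal_gen S" unfolding ideal_gen_def mem_Collect_eq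
    by (intro exI[of _ "F \<union> F'"] exI conjI)
next
  fix a r assume "a \<in> ideal_gen S"
  then obtain F h where F: "finite F" "F \<subseteq> S" "a = (\<Sum>s\<in>F. h s * s)"
    unfolding ideal_gen_def by blast
  have "r * a = (\<Sum>s\<in>F. (r * h s) * s)" by (simp add: F sum_distrib_left mult.assoc)
  with F(1,2) show "r * a \<in> ideal_gen S" unfolding ideal_gen_def mem_Collect_eq
    by (intro exI[of _ F] exI conjI)
qed

lemma ideal_gen_least: "ring_ideal I \<Longrightarrow> S \<subseteq> I \<Longrightarrow> ideal_gen S \<subseteq> I"
  by (auto simp: ideal_gen_def intro!: ring_ideal.sum ring_ideal.mult)

lemma ideal_gen_superset: "s \<in> S \<Longrightarrow> s \<in> ideal_gen S"
  unfolding ideal_gen_def by (auto intro!: exI[of _ "{s}"] exI[of _ "\<lambda>_. 1"])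

lemma ring_ideal_vimage:
  assumes "comm_ring_hom \<phi>" "ring_ideal I"
  shows "ring_ideal (\<phi> -` I)"
proof -
  interpret comm_ring_hom \<phi> by fact
  interpret I: ring_ideal I by fact
  show ?thesis by unfold_locales (auto simp: hom_distribs intro: I.zero I.add I.mult)
qed

lemma hom_ideal_gen:
  assumes "comm_ring_hom \<phi>" "a \<in> ideal_gen S" "\<phi> ` S \<subseteq> T"
  shows "\<phi> a \<in> ideal_gen T"
  using ideal_gen_least[OF ring_ideal_vimage[OF assms(1) ring_ideal_ideal_gen, of T], of S] assms(2,3)
    ideal_gen_superset by blast

lemma ring_ideal_radical:
  assumes "ring_ideal I"
  shows "ring_ideal (radical I)"
proof -
  interpret ring_ideal I by fact
  show ?thesis
  proof
    show "0 \<in> radical I" unfolding radical_def using zero by (auto intro!: exI[of _ 1])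
  next
    fix a b assume "a \<in> radical I" "b \<in> radical I"
    then obtain m n where mn: "a ^ m \<in> I" "b ^ n \<in> I" by (auto simp: radical_def)
    have "(a + b) ^ (m + n) = (\<Sum>i\<le>m + n. of_nat ((m + n) choose i) * a ^ i * b ^ (m + n - i))"
      by (rule binomial_ring)
    also have "\<dots> \<in> I"
    proof (rule sum)
      fix i
      show "of_nat ((m + n) choose i) * a ^ i * b ^ (m + n - i) \<in> I"
      proof (cases "i \<ge> m")
        case True
        then have "a ^ i = a ^ (i - m) * a ^ m" by (simp flip: power_add)
        then show ?thesis using mn(1) mult mult_right by metis
      next
        case False
        then have "m + n - i = (m - i) + n" by simp
        then have "b ^ (m + n - i) = b ^ (m - i) * b ^ n" by (simp only: power_add)
        then show ?thesis using mn(2) mult by metis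
      qed
    qed
    finally show "a + b \<in> radical I" unfolding radical_def by blast
  next
    fix a r assume "a \<in> radical I"
    then show "r * a \<in> radical I" unfolding radical_def by (auto simp: power_mult_distrib intro: mult)
  qed
qed

text \<open>Serves to move the support of a monomial to any other set of the same size; bijections
  on the sets and on their complements are glued.\<close>

lemma exists_permutes_image_eq:
  assumes "finite U" "S \<subseteq> U" "T \<subseteq> U" "card S = card T"
  obtains \<rho> where "\<rho> permutes U" "\<rho> ` S = T"
proof -
  have fin: "finite S" "finite T" using assms finite_subset by auto
  obtain g where g: "bij_betw g S T" using finite_same_card_bij fin assms(4) by blast
  have "card (U - S) = card (U - T)" using assms fin by (simp add: card_Diff_subset)
  then obtain h where h: "bij_betw h (U - S) (U - T)" using finite_same_card_bij assms(1) by blast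
  define \<rho> where "\<rho> x = (if x \<in> S then g x else if x \<in> U then h x else x)" for x
  have gS: "bij_betw \<rho> S T" using g by (rule bij_betw_cong[THEN iffD1, rotated]) (simp add: \<rho>_def)
  moreover have "bij_betw \<rho> (U - S) (U - T)"
    using h by (rule bij_betw_cong[THEN iffD1, rotated]) (simp add: \<rho>_def)
  ultimately have "bij_betw \<rho> (S \<union> (U - S)) (T \<union> (U - T))" by (rule bij_betw_combine) auto
  moreover have "S \<union> (U - S) = U" "T \<union> (U - T) = U" using assms by auto
  ultimately have "bij_betw \<rho> U U" by simp
  then have "\<rho> permutes U" by (rule bij_imp_permutes) (use assms in \<open>auto simp: \<rho>_def\<close>)
  then show ?thesis using that gS bij_betw_imp_surj_on by blast
qed

text \<open>With indeterminate coefficients a single identity covers all specialisations, and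
  \<open>p\<close> later cuts out the open set of general coefficients. Denominators are kept as the
  factor \<open>p\<close>, since a polynomial can be evaluated at any coefficients.\<close>

lemma generic_monomial_power_in_ideal:
  fixes A :: "(nat \<Rightarrow>\<^sub>0 nat) set" and f :: "(((nat \<Rightarrow>\<^sub>0 nat) \<Rightarrow>\<^sub>0 nat) \<Rightarrow>\<^sub>0 'k::field_char_0) mpoly"
  assumes n: "n > 0" and A_fin: "finite A"
    and A_vars: "\<And>\<alpha>. \<alpha> \<in> A \<Longrightarrow> Poly_Mapping.keys \<alpha> \<subseteq> {..<n}"
    and A_hom: "\<And>\<alpha>. \<alpha> \<in> A \<Longrightarrow> exp_deg \<alpha> = d"
    and A_sym: "\<And>\<sigma> \<alpha>. \<sigma> permutes {..<n} \<Longrightarrow> \<alpha> \<in> A \<Longrightarrow> perm_exp \<sigma> \<alpha> \<in> A"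
    and \<gamma>: "\<gamma> \<in> A" "card (Poly_Mapping.keys \<gamma>) = k"
    and f: "f = poly_of_coeffs A var"
  shows "\<exists>p N. p \<noteq> 0 \<and> (\<forall>m\<in>Poly_Mapping.keys p. Poly_Mapping.keys m \<subseteq> A) \<and>
    Poly_Mapping.single 0 p * sqfree_mono k ^ N \<in> ideal_gen (Sn_orbit n f)"
proof (rule ccontr)
  assume contra: "\<not> ?thesis"
  \<comment> \<open>The ring \<open>K[c]\<close>. The type has a variable for every exponent vector,
    so the variables are restricted to \<open>A\<close>.\<close>
  define CA :: "(((nat \<Rightarrow>\<^sub>0 nat) \<Rightarrow>\<^sub>0 nat) \<Rightarrow>\<^sub>0 'k) set"
    where "CA = {p. \<forall>m\<in>Poly_Mapping.keys p. Poly_Mapping.keys m \<subseteq> A}"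
  define S where "S = (Poly_Mapping.single (0 :: nat \<Rightarrow>\<^sub>0 nat)) ` CA"
  \<comment> \<open>Missing this multiplicative set means at once that \<open>P\<close> contains no
    nonzero element of \<open>K[c]\<close> and no variable dividing
    \<open>sqfree_mono k\<close>.\<close>
  define M where "M = {Poly_Mapping.single 0 p * sqfree_mono k ^ N | p N. p \<in> CA \<and> p \<noteq> 0}"
  interpret CA: subring_set CA
  proof
    show "1 \<in> CA" by (simp add: CA_def)
  next
    fix a b assume *: "a \<in> CA" "b \<in> CA"
    then show "a - b \<in> CA" unfolding CA_def by (auto dest!: keys_diff[THEN subsetD])
    show "a * b \<in> CA"
      unfolding CA_def using * by (auto simp: CA_def dest!: keys_mult[THEN subsetD] keys_add[THEN subsetD])
  qed
  interpret cst: comm_ring_hom "Poly_Mapping.single (0 :: nat \<Rightarrow>\<^sub>0 nat) :: (((nat \<Rightarrow>\<^sub>0 nat) \<Rightarrow>\<^sub>0 nat) \<Rightarrow>\<^sub>0 'k) \<Rightarrow> _"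
    by (rule comm_ring_hom_single)
  interpret S: subring_set S
  proof
    show "1 \<in> S" unfolding S_def using CA.one by (metis image_eqI cst.hom_one)
  next
    fix a b assume "a \<in> S" "b \<in> S"
    then obtain p q where "p \<in> CA" "q \<in> CA" "a = Poly_Mapping.single 0 p" "b = Poly_Mapping.single 0 q"
      by (auto simp: S_def)
    then show "a - b \<in> S" "a * b \<in> S"
      unfolding S_def by (metis CA.diff cst.hom_minus image_eqI, metis CA.mult cst.hom_mult image_eqI)
  qed
  have M1: "1 \<in> M" unfolding M_def mem_Collect_eq
    by (rule exI[of _ 1], rule exI[of _ 0]) (auto simp: CA.one)
  have M_mult: "a * b \<in> M" if "a \<in> M" "b \<in> M" for a b
  proof -
    from that obtain p N q N' where *: "a = Poly_Mapping.single 0 p * sqfree_mono k ^ N" "p \<in> CA" "p \<noteq> 0"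
       "b = Poly_Mapping.single 0 q * sqfree_mono k ^ N'" "q \<in> CA" "q \<noteq> 0"
      by (auto simp: M_def)
    then have "a * b = Poly_Mapping.single 0 (p * q) * sqfree_mono k ^ (N + N')"
      by (simp add: cst.hom_mult power_add algebra_simps)
    moreover have "p * q \<in> CA" "p * q \<noteq> 0" using * by (auto intro: CA.mult)
    ultimately show ?thesis unfolding M_def by blast
  qed
  have disj: "ideal_gen (Sn_orbit n f) \<inter> M = {}"
    using contra by (auto simp: M_def CA_def)
  obtain P where P: "prime_ring_ideal P" and fP: "ideal_gen (Sn_orbit n f) \<subseteq> P" and PM: "P \<inter> M = {}"
    by (rule prime_ring_ideal_avoiding[OF ring_ideal_ideal_gen M1 M_mult disj])
  interpret P: prime_ring_ideal P by fact
  have cst_notin: "Poly_Mapping.single 0 p \<notin> P" if "p \<in> CA" "p \<noteq> 0" for p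
  proof -
    have "Poly_Mapping.single 0 p \<in> M"
      unfolding M_def mem_Collect_eq by (rule exI[of _ p], rule exI[of _ 0]) (simp add: that)
    then show ?thesis using PM by blast
  qed
  have var_notin: "var i \<notin> P" if "i < k" for i
  proof
    assume "var i \<in> P"
    then have "sqfree_mono k \<in> P"
      unfolding sqfree_mono_conv_prod using that
      by (subst prod.remove[of _ i]) (auto intro: P.mult_right)
    moreover have "sqfree_mono k \<in> M"
      unfolding M_def mem_Collect_eq by (rule exI[of _ 1], rule exI[of _ 1]) (simp add: CA.one)
    ultimately show False using PM by blast
  qed
  have nat_notin: "of_nat e \<notin> P" if "e > 0" for e
    using cst_notin[of "of_nat e"] that CA.of_nat by (simp add: cst.hom_of_nat)
  have bij: "bij \<sigma>" if "\<sigma> permutes {..<n}" for \<sigma> using that by (rule permutes_bij)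
  \<comment> \<open>\<open>t \<sigma> \<beta>\<close> is the term of \<open>\<sigma>.f\<close> that
    comes from \<open>\<beta>\<close>.\<close>
  define t :: "(nat \<Rightarrow> nat) \<Rightarrow> (nat \<Rightarrow>\<^sub>0 nat) \<Rightarrow> (((nat \<Rightarrow>\<^sub>0 nat) \<Rightarrow>\<^sub>0 nat) \<Rightarrow>\<^sub>0 'k) mpoly"
    where "t \<sigma> \<beta> = Poly_Mapping.single (perm_exp \<sigma> \<beta>) (var \<beta>)" for \<sigma> \<beta>
  have orbit: "(\<Sum>\<beta>\<in>A. t \<sigma> \<beta>) \<in> P" if "\<sigma> permutes {..<n}" for \<sigma>
  proof -
    have "perm_poly \<sigma> f \<in> P"
      using fP that by (auto intro!: ideal_gen_superset simp: Sn_orbit_def)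
    then show ?thesis by (simp add: f perm_poly_of_coeffs[OF bij[OF that]] t_def)
  qed
  have t_prod: "t \<sigma> \<beta> = Poly_Mapping.single 0 (var \<beta>) * mono_eval var (perm_exp \<sigma> \<beta>)" for \<sigma> \<beta>
    by (simp add: t_def mono_eval_var mult_single)
  have var_CA: "var \<beta> \<in> CA" "var \<beta> \<noteq> (0 :: ((nat \<Rightarrow>\<^sub>0 nat) \<Rightarrow>\<^sub>0 nat) \<Rightarrow>\<^sub>0 'k)" if "\<beta> \<in> A" for \<beta>
    using that by (auto simp: CA_def var_def) (metis keys_single insert_not_empty keys_zero zero_neq_one)
  have t_adjoin: "t \<sigma> \<beta> \<in> adjoin_upto S var n" if "\<sigma> permutes {..<n}" "\<beta> \<in> A" for \<sigma> \<beta>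
  proof -
    interpret R: subring_set "adjoin_upto S var n" by (rule subring_adjoin_upto) (rule S.subring_set_axioms)
    have "Poly_Mapping.single 0 (var \<beta>) \<in> adjoin_upto S var n"
      using subset_adjoin_upto[OF S.subring_set_axioms] var_CA[OF that(2)] by (auto simp: S_def)
    moreover have "Poly_Mapping.keys (perm_exp \<sigma> \<beta>) \<subseteq> {..<n}"
      using A_sym[OF that] A_vars by blast
    then have "mono_eval var (perm_exp \<sigma> \<beta>) \<in> adjoin_upto S var n"
      unfolding mono_eval_def
      by (intro R.prod R.power generator_in_adjoin_upto S.subring_set_axioms) auto
    ultimately show ?thesis unfolding t_prod by (rule R.mult)
  qed
  \<comment> \<open>The weight \<open>w\<close> gives a derivation of \<open>K[c]\<close>, which is
    extended modulo \<open>P\<close> and applied to \<open>\<sigma>.f\<close>. The order of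
    quantifiers is the point: \<open>q\<close> and \<open>l\<close> are found before
    \<open>\<sigma>\<close>.\<close>
  have tangent: "\<exists>q l. q \<notin> P \<and> (\<forall>\<sigma>. \<sigma> permutes {..<n} \<longrightarrow>
      (\<Sum>\<beta>\<in>A. (q * of_nat (w (Poly_Mapping.single \<beta> 1)) +
        (\<Sum>i<n. l i * of_nat (Poly_Mapping.lookup (perm_exp \<sigma> \<beta>) i))) * t \<sigma> \<beta>) \<in> P)"
    if w: "\<And>m m'. w (m + m') = w m + w m'" for w :: "((nat \<Rightarrow>\<^sub>0 nat) \<Rightarrow>\<^sub>0 nat) \<Rightarrow> nat"
  proof -
    define d where "d = (weight_derivation w :: (((nat \<Rightarrow>\<^sub>0 nat) \<Rightarrow>\<^sub>0 nat) \<Rightarrow>\<^sub>0 'k) \<Rightarrow> _)"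
    define W where "W = (coeff_derivation d :: (((nat \<Rightarrow>\<^sub>0 nat) \<Rightarrow>\<^sub>0 nat) \<Rightarrow>\<^sub>0 'k) mpoly \<Rightarrow> _)"
    define \<theta> where "\<theta> i = (weight_derivation (\<lambda>m. Poly_Mapping.lookup m i) ::
        (((nat \<Rightarrow>\<^sub>0 nat) \<Rightarrow>\<^sub>0 nat) \<Rightarrow>\<^sub>0 'k) mpoly \<Rightarrow> _)" for i
    have d: "derivation d" unfolding d_def by (rule derivation_weight_derivation) (rule w)
    have W: "derivation W" unfolding W_def by (rule derivation_coeff_derivation) (rule d)
    have \<theta>: "derivation (\<theta> i)" for i
      unfolding \<theta>_def by (rule derivation_weight_derivation) (rule lookup_add)
    have W_single: "W (Poly_Mapping.single m a) = Poly_Mapping.single m (d a)" for m a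
      unfolding W_def by (rule coeff_derivation_single) (rule d)
    have "\<exists>q l. q \<notin> P \<and> (\<forall>a\<in>adjoin_upto S var n. a \<in> P \<longrightarrow> q * W a + (\<Sum>i<n. l i * \<theta> i a) \<in> P)"
    proof (rule derivation_extend_upto[OF P nat_notin S.subring_set_axioms W \<theta>])
      show "\<theta> i a = 0" if "a \<in> S" for i a
        using that by (auto simp: S_def \<theta>_def weight_derivation_single)
      show "\<theta> i (var j) = (if i = j then var j else 0)" for i j
        by (auto simp: \<theta>_def var_def weight_derivation_single lookup_single when_def)
      show "W (var i) = 0" for i
        by (simp add: var_def W_single derivation.one[OF d])
      \<comment> \<open>\<open>P\<close> meets the copy \<open>S\<close> of \<open>K[c]\<close> only
        in zero, so any derivation respects \<open>P\<close> there.\<close>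
      show "W a \<in> P" if aS: "a \<in> S" and aP: "a \<in> P" for a
      proof -
        obtain p where "p \<in> CA" "a = Poly_Mapping.single 0 p" using aS by (auto simp: S_def)
        then have "a = 0" using aP cst_notin[of p] by (cases "p = 0") auto
        then show ?thesis by (simp add: derivation.zero[OF W] P.zero)
      qed
    qed
    then obtain q l where q: "q \<notin> P"
      and l: "\<And>a. a \<in> adjoin_upto S var n \<Longrightarrow> a \<in> P \<Longrightarrow> q * W a + (\<Sum>i<n. l i * \<theta> i a) \<in> P"
      by blast
    have "(\<Sum>\<beta>\<in>A. (q * of_nat (w (Poly_Mapping.single \<beta> 1)) +
        (\<Sum>i<n. l i * of_nat (Poly_Mapping.lookup (perm_exp \<sigma> \<beta>) i))) * t \<sigma> \<beta>) \<in> P"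
      if \<sigma>: "\<sigma> permutes {..<n}" for \<sigma>
    proof -
      define D where "D a = q * W a + (\<Sum>i<n. l i * \<theta> i a)" for a
      interpret D: derivation D
        unfolding D_def by (intro derivation_plus derivation_smult derivation_sum W \<theta>)
      interpret R: subring_set "adjoin_upto S var n" by (rule subring_adjoin_upto) (rule S.subring_set_axioms)
      have Wt: "W (t \<sigma> \<beta>) = of_nat (w (Poly_Mapping.single \<beta> 1)) * t \<sigma> \<beta>" for \<beta>
        by (simp add: t_def W_single d_def var_def weight_derivation_single mult_single
            flip: single_of_nat)
      have \<theta>t: "\<theta> i (t \<sigma> \<beta>) = of_nat (Poly_Mapping.lookup (perm_exp \<sigma> \<beta>) i) * t \<sigma> \<beta>" for i \<beta>
        unfolding t_def \<theta>_def weight_derivation_single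
        by (subst single_of_nat[symmetric]) (simp only: mult_single add_0)
      have "D (\<Sum>\<beta>\<in>A. t \<sigma> \<beta>) \<in> P"
        unfolding D_def by (rule l) (auto intro!: R.sum t_adjoin \<sigma> orbit)
      also have "D (\<Sum>\<beta>\<in>A. t \<sigma> \<beta>) = (\<Sum>\<beta>\<in>A. (q * of_nat (w (Poly_Mapping.single \<beta> 1)) +
        (\<Sum>i<n. l i * of_nat (Poly_Mapping.lookup (perm_exp \<sigma> \<beta>) i))) * t \<sigma> \<beta>)"
        unfolding D.sum
        by (rule sum.cong[OF refl]) (simp add: D_def Wt \<theta>t distrib_right sum_distrib_right mult.assoc)
      finally show ?thesis .
    qed
    then show ?thesis using q by blast
  qed
  \<comment> \<open>The moment vector: the exponent vectors \<open>\<beta>\<close>, weighted by the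
    terms of \<open>\<sigma>.f\<close>.\<close>
  define \<mu> where "\<mu> \<sigma> j = (\<Sum>\<beta>\<in>A. of_nat (Poly_Mapping.lookup \<beta> j) * t \<sigma> \<beta>)" for \<sigma> j
  \<comment> \<open>The exponent of \<open>x_(\<sigma> i)\<close> in
    \<open>perm_exp \<sigma> \<beta>\<close> is that of \<open>x_i\<close> in
    \<open>\<beta>\<close>. Hence the correction terms form a linear form in the moments whose
    coefficients are permuted by \<open>\<sigma>\<close>.\<close>
  have second: "(\<Sum>\<beta>\<in>A. (\<Sum>i<n. l i * of_nat (Poly_Mapping.lookup (perm_exp \<sigma> \<beta>) i)) * t \<sigma> \<beta>) =
      (\<Sum>i<n. l (\<sigma> i) * \<mu> \<sigma> i)" if \<sigma>: "\<sigma> permutes {..<n}" for \<sigma> l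
  proof -
    have "(\<Sum>i<n. l i * of_nat (Poly_Mapping.lookup (perm_exp \<sigma> \<beta>) i)) =
      (\<Sum>i<n. l (\<sigma> i) * of_nat (Poly_Mapping.lookup \<beta> i))" for \<beta>
    proof -
      have "(\<Sum>i<n. l i * of_nat (Poly_Mapping.lookup (perm_exp \<sigma> \<beta>) i)) =
        (\<Sum>i<n. l (\<sigma> i) * of_nat (Poly_Mapping.lookup (perm_exp \<sigma> \<beta>) (\<sigma> i)))"
        by (rule sum.permute[OF \<sigma>, unfolded comp_def])
      then show ?thesis
        using permutes_inverses[OF \<sigma>] by (simp add: lookup_perm_exp[OF bij[OF \<sigma>]])
    qed
    then have "(\<Sum>\<beta>\<in>A. (\<Sum>i<n. l i * of_nat (Poly_Mapping.lookup (perm_exp \<sigma> \<beta>) i)) * t \<sigma> \<beta>) =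
      (\<Sum>\<beta>\<in>A. \<Sum>i<n. l (\<sigma> i) * (of_nat (Poly_Mapping.lookup \<beta> i) * t \<sigma> \<beta>))"
      by (simp add: sum_distrib_right mult.assoc)
    also have "\<dots> = (\<Sum>i<n. \<Sum>\<beta>\<in>A. l (\<sigma> i) * (of_nat (Poly_Mapping.lookup \<beta> i) * t \<sigma> \<beta>))"
      by (rule sum.swap)
    finally show ?thesis by (simp add: \<mu>_def sum_distrib_left)
  qed
  \<comment> \<open>By homogeneity the moments add up to \<open>d\<close> times
    \<open>\<sigma>.f\<close>.\<close>
  have \<mu>_sum: "(\<Sum>j<n. \<mu> \<sigma> j) \<in> P" if "\<sigma> permutes {..<n}" for \<sigma>
  proof -
    have deg: "(\<Sum>j<n. Poly_Mapping.lookup \<beta> j) = d" if "\<beta> \<in> A" for \<beta>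
    proof -
      have "(\<Sum>j<n. Poly_Mapping.lookup \<beta> j) = exp_deg \<beta>"
        unfolding exp_deg_def
        by (rule sum.mono_neutral_right) (use A_vars[OF that] in \<open>auto simp: in_keys_iff\<close>)
      then show ?thesis using A_hom[OF that] by simp
    qed
    have "(\<Sum>j<n. \<mu> \<sigma> j) = (\<Sum>\<beta>\<in>A. \<Sum>j<n. of_nat (Poly_Mapping.lookup \<beta> j) * t \<sigma> \<beta>)"
      unfolding \<mu>_def by (rule sum.swap)
    also have "\<dots> = (\<Sum>\<beta>\<in>A. of_nat d * t \<sigma> \<beta>)"
      by (rule sum.cong[OF refl]) (simp add: deg flip: sum_distrib_right of_nat_sum)
    also have "\<dots> = of_nat d * (\<Sum>\<beta>\<in>A. t \<sigma> \<beta>)" by (simp add: sum_distrib_left)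
    also have "\<dots> \<in> P" using orbit[OF that] by (rule P.mult)
    finally show ?thesis .
  qed
  \<comment> \<open>If all moments were in \<open>P\<close>, the Euler operator of one coefficient
    variable would put a single term of \<open>\<sigma>.f\<close> into \<open>P\<close>. A term
    whose monomial involves only \<open>x_i\<close> with \<open>i < k\<close> then gives a
    contradiction.\<close>
  have \<mu>_notin: "\<exists>r<n. \<mu> \<sigma> r \<notin> P" if \<sigma>: "\<sigma> permutes {..<n}" for \<sigma>
  proof (rule ccontr)
    assume "\<not> ?thesis"
    then have \<mu>P: "\<mu> \<sigma> r \<in> P" if "r < n" for r using that by blast
    have "k \<le> n" using A_vars[OF \<gamma>(1)] \<gamma>(2) by (metis card_lessThan card_mono finite_lessThan)
    then obtain \<rho> where \<rho>: "\<rho> permutes {..<n}" "\<rho> ` Poly_Mapping.keys \<gamma> = {..<k}"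
      using exists_permutes_image_eq[of "{..<n}" "Poly_Mapping.keys \<gamma>" "{..<k}"] A_vars[OF \<gamma>(1)] \<gamma>(2) by auto
    have inv: "inv_into UNIV \<sigma> permutes {..<n}" using \<sigma> by (rule permutes_inv)
    \<comment> \<open>Chosen so that \<open>\<sigma>\<close> carries \<open>\<delta>\<close> to an
      exponent vector with support \<open>{..<k}\<close>; symmetry keeps \<open>\<delta>\<close> in
      \<open>A\<close>.\<close>
    define \<delta> where "\<delta> = perm_exp (inv_into UNIV \<sigma>) (perm_exp \<rho> \<gamma>)"
    have \<delta>A: "\<delta> \<in> A" unfolding \<delta>_def by (intro A_sym inv \<rho>(1) \<gamma>(1))
    have "perm_exp \<sigma> \<delta> = perm_exp \<rho> \<gamma>"
      unfolding \<delta>_def perm_exp_comp[OF bij[OF \<sigma>] bij[OF inv]]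
      by (rule poly_mapping_eqI) (simp add: lookup_perm_exp permutes_inv_o(1)[OF \<sigma>] flip: id_def)
    then have keys: "Poly_Mapping.keys (perm_exp \<sigma> \<delta>) = {..<k}"
      using \<rho> by (simp add: keys_perm_exp[OF bij])
    \<comment> \<open>The weight is the exponent of the variable \<open>var \<delta>\<close>, which
      singles out the term of \<open>\<delta>\<close>.\<close>
    obtain q l where q: "q \<notin> P" and l: "(\<Sum>\<beta>\<in>A. (q * of_nat (Poly_Mapping.lookup (Poly_Mapping.single \<beta> 1) \<delta>) +
        (\<Sum>i<n. l i * of_nat (Poly_Mapping.lookup (perm_exp \<sigma> \<beta>) i))) * t \<sigma> \<beta>) \<in> P"
      using tangent[of "\<lambda>m. Poly_Mapping.lookup m \<delta>"] \<sigma> by (auto simp: lookup_add)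
    have "(\<Sum>\<beta>\<in>A. (q * of_nat (Poly_Mapping.lookup (Poly_Mapping.single \<beta> 1) \<delta>)) * t \<sigma> \<beta>) =
        (\<Sum>\<beta>\<in>A. if \<beta> = \<delta> then q * t \<sigma> \<beta> else 0)"
      by (rule sum.cong) (auto simp: lookup_single when_def)
    also have "\<dots> = q * t \<sigma> \<delta>" using \<delta>A A_fin by simp
    finally have "q * t \<sigma> \<delta> + (\<Sum>i<n. l (\<sigma> i) * \<mu> \<sigma> i) \<in> P"
      using l by (simp only: distrib_right sum.distrib second[OF \<sigma>])
    then have "q * t \<sigma> \<delta> \<in> P" by (rule P.add_cancel_right) (intro P.sum P.mult \<mu>P, simp)
    then have "t \<sigma> \<delta> \<in> P" using q P.prime by blast
    then have "mono_eval var (perm_exp \<sigma> \<delta>) \<in> P"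
      unfolding t_prod using P.prime cst_notin var_CA[OF \<delta>A] by blast
    then obtain i where "i < k" "var i \<in> P"
      unfolding mono_eval_def keys using P.prod_in P.power_in by blast
    then show False using var_notin by blast
  qed
  have "\<exists>q l. q \<notin> P \<and> (\<forall>\<sigma>. \<sigma> permutes {..<n} \<longrightarrow> q * \<mu> \<sigma> j + (\<Sum>i<n. l (\<sigma> i) * \<mu> \<sigma> i) \<in> P)" for j
  proof -
    \<comment> \<open>The weight of the derivation that multiplies \<open>var \<beta>\<close> by the
      \<open>j\<close>-th entry of \<open>\<beta>\<close>; the terms of \<open>\<sigma>.f\<close>
      weighted in this way add up to \<open>\<mu> \<sigma> j\<close>.\<close>
    define w where "w m = (\<Sum>\<beta>\<in>A. Poly_Mapping.lookup m \<beta> * Poly_Mapping.lookup \<beta> j)" for m :: "(nat \<Rightarrow>\<^sub>0 nat) \<Rightarrow>\<^sub>0 nat"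
    have "w (m + m') = w m + w m'" for m m'
      by (simp add: w_def lookup_add distrib_right sum.distrib)
    from tangent[of w, OF this] obtain q l where q: "q \<notin> P"
      and l: "\<And>\<sigma>. \<sigma> permutes {..<n} \<Longrightarrow>
        (\<Sum>\<beta>\<in>A. (q * of_nat (w (Poly_Mapping.single \<beta> 1)) +
        (\<Sum>i<n. l i * of_nat (Poly_Mapping.lookup (perm_exp \<sigma> \<beta>) i))) * t \<sigma> \<beta>) \<in> P" by blast
    have w_single: "w (Poly_Mapping.single \<beta> 1) = Poly_Mapping.lookup \<beta> j" if "\<beta> \<in> A" for \<beta>
    proof -
      have "w (Poly_Mapping.single \<beta> 1) = (\<Sum>\<beta>'\<in>A. if \<beta>' = \<beta> then Poly_Mapping.lookup \<beta>' j else 0)"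
        unfolding w_def by (rule sum.cong) (auto simp: lookup_single when_def)
      then show ?thesis using that A_fin by simp
    qed
    have "q * \<mu> \<sigma> j + (\<Sum>i<n. l (\<sigma> i) * \<mu> \<sigma> i) \<in> P" if \<sigma>: "\<sigma> permutes {..<n}" for \<sigma>
    proof -
      have "(\<Sum>\<beta>\<in>A. (q * of_nat (w (Poly_Mapping.single \<beta> 1))) * t \<sigma> \<beta>) = q * \<mu> \<sigma> j"
        unfolding \<mu>_def sum_distrib_left by (rule sum.cong) (simp_all only: w_single mult.assoc)
      then show ?thesis using l[OF \<sigma>] by (simp only: distrib_right sum.distrib second[OF \<sigma>])
    qed
    then show ?thesis using q by blast
  qed
  then have "\<exists>Q. \<forall>j. \<exists>l. Q j \<notin> P \<and>
      (\<forall>\<sigma>. \<sigma> permutes {..<n} \<longrightarrow> Q j * \<mu> \<sigma> j + (\<Sum>i<n. l (\<sigma> i) * \<mu> \<sigma> i) \<in> P)"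
    by (intro choice allI)
  then obtain Q where "\<forall>j. \<exists>l. Q j \<notin> P \<and>
      (\<forall>\<sigma>. \<sigma> permutes {..<n} \<longrightarrow> Q j * \<mu> \<sigma> j + (\<Sum>i<n. l (\<sigma> i) * \<mu> \<sigma> i) \<in> P)" ..
  then have "\<exists>L. \<forall>j. Q j \<notin> P \<and>
      (\<forall>\<sigma>. \<sigma> permutes {..<n} \<longrightarrow> Q j * \<mu> \<sigma> j + (\<Sum>i<n. L j (\<sigma> i) * \<mu> \<sigma> i) \<in> P)"
    by (rule choice)
  then obtain L where Q: "\<And>j. Q j \<notin> P"
    and L: "\<And>j \<sigma>. \<sigma> permutes {..<n} \<Longrightarrow> Q j * \<mu> \<sigma> j + (\<Sum>i<n. L j (\<sigma> i) * \<mu> \<sigma> i) \<in> P"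
    by blast
  \<comment> \<open>subtracting the row mean from \<open>L\<close>, multiplied by \<open>n\<close> to avoid denominators\<close>
  define a where "a j = of_nat n * Q j" for j
  define B where "B j i = of_nat n * L j i - (\<Sum>i<n. L j i)" for j i
  have B0: "(\<Sum>i<n. B j i) = 0" for j
    by (simp add: B_def sum_subtractf flip: sum_distrib_left)
  have "det (mat n n (\<lambda>(j, i). (if j = i then a j else 0) + B j (\<sigma> i))) \<in> P"
    if \<sigma>: "\<sigma> permutes {..<n}" for \<sigma>
  proof -
    obtain r where r: "r < n" "\<mu> \<sigma> r \<notin> P" using \<mu>_notin[OF \<sigma>] by blast
    show ?thesis
    proof (rule det_in_prime_if_kernel[where v = "\<mu> \<sigma>", OF P _ r])
      fix j assume j: "j < n"
      have "(\<Sum>i<n. ((if j = i then a j else 0) + B j (\<sigma> i)) * \<mu> \<sigma> i) =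
        (\<Sum>i<n. if j = i then a j * \<mu> \<sigma> i else 0) + (\<Sum>i<n. B j (\<sigma> i) * \<mu> \<sigma> i)"
        by (simp add: distrib_right sum.distrib if_distrib[of "\<lambda>x. x * _"] cong: if_cong)
      \<comment> \<open>The subtracted row sum of \<open>L\<close> contributes only a multiple of
        the coordinate sum of \<open>\<mu> \<sigma>\<close>, which lies in \<open>P\<close>. So
        \<open>\<mu> \<sigma>\<close> stays in the kernel modulo \<open>P\<close>.\<close>
      also have "\<dots> = of_nat n * (Q j * \<mu> \<sigma> j + (\<Sum>i<n. L j (\<sigma> i) * \<mu> \<sigma> i)) - (\<Sum>i<n. L j i) * (\<Sum>i<n. \<mu> \<sigma> i)"
        using j by (simp add: a_def B_def left_diff_distrib sum_subtractf distrib_left mult.assoc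
            flip: sum_distrib_left)
      also have "\<dots> \<in> P" by (intro P.diff P.mult L \<sigma> \<mu>_sum)
      finally show "(\<Sum>i<n. ((if j = i then a j else 0) + B j (\<sigma> i)) * \<mu> \<sigma> i) \<in> P" .
    qed
  qed
  then have "(\<Sum>\<sigma> | \<sigma> permutes {..<n}. det (mat n n (\<lambda>(j, i). (if j = i then a j else 0) + B j (\<sigma> i)))) \<in> P"
    by (intro P.sum) auto
  \<comment> \<open>Summing over the whole group eliminates the unknown \<open>B\<close>, and what
    is left is a product of elements outside \<open>P\<close>.\<close>
  then have "of_nat (fact n) * (\<Prod>j<n. a j) \<in> P"
    unfolding sum_det_column_permutations[of n B a, OF B0] .
  then have "(\<Prod>j<n. a j) \<in> P" using P.prime nat_notin[of "fact n"] by auto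
  then obtain j where "a j \<in> P" using P.prod_in by blast
  then show False using P.prime nat_notin[OF n] Q by (auto simp: a_def)
qed

section \<open>Specialisation\<close>

lemma perm_poly_Sn_orbit:
  assumes "\<sigma> permutes {..<n}" "s \<in> Sn_orbit n f"
  shows "perm_poly \<sigma> s \<in> Sn_orbit n f"
proof -
  obtain \<tau> where \<tau>: "\<tau> permutes {..<n}" "s = perm_poly \<tau> f" using assms(2) by (auto simp: Sn_orbit_def)
  then have "perm_poly \<sigma> s = perm_poly (\<sigma> \<circ> \<tau>) f"
    using assms(1) by (simp add: perm_poly_comp permutes_bij)
  moreover have "\<sigma> \<circ> \<tau> permutes {..<n}" using \<tau>(1) assms(1) by (rule permutes_compose)
  ultimately show ?thesis by (auto simp: Sn_orbit_def)
qed

section \<open>The square-free monomial ideal\<close>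

lemma lookup_sum_single_one:
  "finite J \<Longrightarrow> Poly_Mapping.lookup (\<Sum>i\<in>J. Poly_Mapping.single i (1::nat)) j = (if j \<in> J then 1 else 0)"
  by (simp add: lookup_sum lookup_single when_def)

lemma keys_sum_single_one: "Poly_Mapping.keys (\<Sum>i<k::nat. Poly_Mapping.single i (1::nat)) = {..<k}"
  by (auto simp: in_keys_iff lookup_sum_single_one simp del: One_nat_def split: if_splits)

text \<open>Such a monomial is a multiple of some permuted \<open>sqfree_mono k\<close>. The
  intersection with \<open>{..<n}\<close> is there because the type has further variables, which the
  permutations fix.\<close>

lemma in_sqfree_ideal_if_keys:
  fixes p :: "'k::comm_ring_1 mpoly"
  assumes "\<And>m. m \<in> Poly_Mapping.keys p \<Longrightarrow> card (Poly_Mapping.keys m \<inter> {..<n}) \<ge> k"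
  shows "p \<in> ideal_gen (Sn_orbit n (sqfree_mono k))"
proof -
  interpret I: ring_ideal "ideal_gen (Sn_orbit n (sqfree_mono k)) :: 'k mpoly set"
    by (rule ring_ideal_ideal_gen)
  let ?e = "\<Sum>i<k. Poly_Mapping.single i (1::nat)"
  have "Poly_Mapping.single m a \<in> ideal_gen (Sn_orbit n (sqfree_mono k))"
    if m: "m \<in> Poly_Mapping.keys p" for m and a :: 'k
  proof -
    obtain T where T: "T \<subseteq> Poly_Mapping.keys m \<inter> {..<n}" "card T = k"
      using assms[OF m] obtain_subset_with_card_n by metis
    then have "k \<le> n" using card_mono[of "{..<n}" T] by auto
    then obtain \<rho> where \<rho>: "\<rho> permutes {..<n}" "\<rho> ` {..<k} = T"
      using exists_permutes_image_eq[of "{..<n}" "{..<k}" T] T by auto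
    have bij: "bij \<rho>" using \<rho>(1) by (rule permutes_bij)
    \<comment> \<open>Subtraction of exponents is truncated. It is exact here, as the subtracted
      exponents are at most 1 and supported in \<open>T\<close>, which is part of the support of
      \<open>m\<close>.\<close>
    have "m = (m - perm_exp \<rho> ?e) + perm_exp \<rho> ?e"
    proof (rule poly_mapping_eqI)
      fix i
      have "Poly_Mapping.lookup (perm_exp \<rho> ?e) i \<le> 1"
        by (simp add: lookup_perm_exp[OF bij] lookup_sum_single_one del: One_nat_def)
      moreover have "Poly_Mapping.lookup m i \<ge> 1" if "Poly_Mapping.lookup (perm_exp \<rho> ?e) i \<noteq> 0"
      proof -
        have "i \<in> Poly_Mapping.keys (perm_exp \<rho> ?e)" using that by (simp add: in_keys_iff)
        then have "i \<in> T" using \<rho>(2) by (simp only: keys_perm_exp[OF bij] keys_sum_single_one)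
        then show ?thesis using T(1) by (auto simp: in_keys_iff)
      qed
      ultimately show "Poly_Mapping.lookup m i = Poly_Mapping.lookup (m - perm_exp \<rho> ?e + perm_exp \<rho> ?e) i"
        unfolding lookup_add lookup_minus by linarith
    qed
    then have "Poly_Mapping.single m a =
        Poly_Mapping.single (m - perm_exp \<rho> ?e) a * Poly_Mapping.single (perm_exp \<rho> ?e) 1"
      by (simp add: mult_single)
    also have "Poly_Mapping.single (perm_exp \<rho> ?e) (1::'k) = perm_poly \<rho> (sqfree_mono k)"
      by (simp only: sqfree_mono_def perm_poly_single)
    also have "Poly_Mapping.single (m - perm_exp \<rho> ?e) a * \<dots> \<in> ideal_gen (Sn_orbit n (sqfree_mono k))"
      by (rule I.mult, rule ideal_gen_superset) (use \<rho>(1) in \<open>auto simp: Sn_orbit_def\<close>)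
    finally show ?thesis .
  qed
  then have "(\<Sum>m\<in>Poly_Mapping.keys p. Poly_Mapping.single m (Poly_Mapping.lookup p m))
      \<in> ideal_gen (Sn_orbit n (sqfree_mono k))"
    by (rule I.sum)
  then show ?thesis by (simp flip: poly_mapping_sum_singles)
qed

text \<open>Suppose a monomial of \<open>p\<close> has fewer than \<open>k\<close> variables among
  the first \<open>n\<close>. Setting the other variables of index below \<open>n\<close> to zero
  kills the orbit, whose terms all have at least \<open>k\<close> variables, hence a power of
  \<open>p\<close> and, in a domain, \<open>p\<close> itself; yet that monomial survives.\<close>

lemma radical_subset_sqfree_ideal:
  fixes c :: "(nat \<Rightarrow>\<^sub>0 nat) \<Rightarrow> 'k::idom"
  assumes "\<And>\<alpha>. \<alpha> \<in> A \<Longrightarrow> Poly_Mapping.keys \<alpha> \<subseteq> {..<n}"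
    and "\<And>\<alpha>. \<alpha> \<in> A \<Longrightarrow> k \<le> card (Poly_Mapping.keys \<alpha>)"
  shows "radical (ideal_gen (Sn_orbit n (poly_of_coeffs A c))) \<subseteq> ideal_gen (Sn_orbit n (sqfree_mono k))"
proof
  fix p assume "p \<in> radical (ideal_gen (Sn_orbit n (poly_of_coeffs A c)))"
  then obtain N where N: "p ^ N \<in> ideal_gen (Sn_orbit n (poly_of_coeffs A c))"
    by (auto simp: radical_def)
  show "p \<in> ideal_gen (Sn_orbit n (sqfree_mono k))"
  proof (rule in_sqfree_ideal_if_keys, rule ccontr)
    fix m0 assume m0: "m0 \<in> Poly_Mapping.keys p" "\<not> k \<le> card (Poly_Mapping.keys m0 \<inter> {..<n})"
    define T where "T = Poly_Mapping.keys m0 \<inter> {..<n}"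
    define x :: "nat \<Rightarrow> 'k mpoly" where "x v = (if v < n \<and> v \<notin> T then 0 else var v)" for v
    define \<phi> where "\<phi> = poly_hom (Poly_Mapping.single 0) x"
    interpret \<phi>: comm_ring_hom \<phi> unfolding \<phi>_def by (intro comm_ring_hom_poly_hom comm_ring_hom_single)
    have x_mono: "mono_eval x m =
        (if Poly_Mapping.keys m \<inter> {..<n} \<subseteq> T then Poly_Mapping.single m 1 else 0)" for m
    proof (cases "Poly_Mapping.keys m \<inter> {..<n} \<subseteq> T")
      case True
      then have "mono_eval x m = mono_eval var m"
        unfolding mono_eval_def by (intro prod.cong) (auto simp: x_def)
      then show ?thesis using True by (simp add: mono_eval_var)
    next
      case False
      then obtain v where "v \<in> Poly_Mapping.keys m" "v < n" "v \<notin> T" by auto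
      then have "v \<in> Poly_Mapping.keys m" "x v = 0" by (simp_all add: x_def)
      then have "mono_eval x m = 0"
        unfolding mono_eval_def by (intro prod_zero) (auto simp: in_keys_iff)
      then show ?thesis using False by simp
    qed
    have \<phi>_single: "\<phi> (Poly_Mapping.single m a) =
        (if Poly_Mapping.keys m \<inter> {..<n} \<subseteq> T then Poly_Mapping.single m a else 0)" for m a
      by (simp add: \<phi>_def poly_hom_single[OF comm_ring_hom_single] x_mono mult_single)
    have "\<phi> ` Sn_orbit n (poly_of_coeffs A c) \<subseteq> {0}"
    proof
      fix s assume "s \<in> \<phi> ` Sn_orbit n (poly_of_coeffs A c)"
      then obtain \<sigma> where \<sigma>: "\<sigma> permutes {..<n}" "s = \<phi> (perm_poly \<sigma> (poly_of_coeffs A c))"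
        by (auto simp: Sn_orbit_def)
      have bij: "bij \<sigma>" using \<sigma>(1) by (rule permutes_bij)
      have "\<phi> (Poly_Mapping.single (perm_exp \<sigma> \<alpha>) (c \<alpha>)) = 0" if "\<alpha> \<in> A" for \<alpha>
      proof -
        have "card (\<sigma> ` Poly_Mapping.keys \<alpha>) \<ge> k"
          using assms(2)[OF that] permutes_inj_on[OF \<sigma>(1)] by (simp add: card_image)
        moreover have "card T < k" using m0(2) by (simp add: T_def)
        moreover have "finite T" by (simp add: T_def)
        ultimately have "\<not> \<sigma> ` Poly_Mapping.keys \<alpha> \<subseteq> T"
          using card_mono[of T "\<sigma> ` Poly_Mapping.keys \<alpha>"] by linarith
        moreover have "\<sigma> ` Poly_Mapping.keys \<alpha> \<subseteq> {..<n}"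
          using assms(1)[OF that] permutes_image[OF \<sigma>(1)] by blast
        ultimately show ?thesis
          by (auto simp: \<phi>_single keys_perm_exp[OF bij])
      qed
      then show "s \<in> {0}"
        by (simp add: \<sigma>(2) perm_poly_of_coeffs[OF bij] \<phi>.hom_sum)
    qed
    then have "\<phi> (p ^ N) \<in> ideal_gen {0}"
      by (rule hom_ideal_gen[OF \<phi>.comm_ring_hom_axioms N])
    also have "ideal_gen {0 :: 'k mpoly} \<subseteq> {0}"
      by (rule ideal_gen_least) (auto intro: ring_ideal.intro)
    finally have "\<phi> p ^ N = 0" by (simp add: \<phi>.hom_power)
    then have "\<phi> p = 0" by (metis power_eq_0_iff)
    \<comment> \<open>\<open>\<phi>\<close> keeps or deletes each monomial and merges none.\<close>
    moreover have "Poly_Mapping.lookup (\<phi> p) m0 = Poly_Mapping.lookup p m0"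
    proof -
      have "\<phi> p = (\<Sum>m\<in>Poly_Mapping.keys p. \<phi> (Poly_Mapping.single m (Poly_Mapping.lookup p m)))"
        by (subst (1) poly_mapping_sum_singles[of p]) (rule \<phi>.hom_sum)
      then have "Poly_Mapping.lookup (\<phi> p) m0 =
          (\<Sum>m\<in>Poly_Mapping.keys p. if m = m0 then Poly_Mapping.lookup p m0 else 0)"
        by (simp only: lookup_sum) (intro sum.cong, auto simp: \<phi>_single lookup_single when_def T_def)
      then show ?thesis using m0(1) by simp
    qed
    ultimately show False using m0(1) by (simp add: in_keys_iff)
  qed
qed

section \<open>Evaluating the coefficient variables\<close>

lemma comm_ring_hom_eval_poly: "comm_ring_hom (\<lambda>P. eval_poly P c)"
proof -
  have "comm_ring_hom (poly_hom (\<lambda>a. a) c)"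
    by (rule comm_ring_hom_poly_hom) (unfold_locales, auto)
  then show ?thesis by (simp add: eval_poly_conv_poly_hom)
qed

text \<open>Evaluation at \<open>c\<close> carries the generic orbit into the orbit of the given
  polynomial and turns \<open>p\<close> into a nonzero, hence invertible, constant.\<close>

lemma specialised_monomial_power_in_ideal:
  fixes c :: "(nat \<Rightarrow>\<^sub>0 nat) \<Rightarrow> 'k::field_char_0"
  assumes "Poly_Mapping.single 0 p * sqfree_mono k ^ N \<in> ideal_gen (Sn_orbit n (poly_of_coeffs A var))"
    and "eval_poly p c \<noteq> 0"
  shows "sqfree_mono k ^ N \<in> ideal_gen (Sn_orbit n (poly_of_coeffs A c))"
proof -
  let ?h = "\<lambda>P. Poly_Mapping.single (0 :: nat \<Rightarrow>\<^sub>0 nat) (eval_poly P c)"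
  have h: "comm_ring_hom ?h"
  proof -
    interpret comm_ring_hom "\<lambda>P. eval_poly P c" by (rule comm_ring_hom_eval_poly)
    show ?thesis by unfold_locales (auto simp: single_add mult_single hom_distribs)
  qed
  define \<phi> where "\<phi> = poly_hom ?h var"
  interpret \<phi>: comm_ring_hom \<phi> unfolding \<phi>_def by (intro comm_ring_hom_poly_hom h)
  have \<phi>_single: "\<phi> (Poly_Mapping.single m a) = Poly_Mapping.single m (eval_poly a c)" for m a
    by (simp add: \<phi>_def poly_hom_single[OF h] mono_eval_var mult_single)
  have eval_var: "eval_poly (var \<alpha>) c = c \<alpha>" for \<alpha>
    by (simp add: eval_poly_def var_def)
  have eval_one: "eval_poly 1 c = 1" by (simp add: eval_poly_def)
  have "\<phi> ` Sn_orbit n (poly_of_coeffs A var) \<subseteq> Sn_orbit n (poly_of_coeffs A c)"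
  proof
    fix s assume "s \<in> \<phi> ` Sn_orbit n (poly_of_coeffs A var)"
    then obtain \<sigma> where \<sigma>: "\<sigma> permutes {..<n}" "s = \<phi> (perm_poly \<sigma> (poly_of_coeffs A var))"
      by (auto simp: Sn_orbit_def)
    have "s = perm_poly \<sigma> (poly_of_coeffs A c)"
      unfolding \<sigma>(2) perm_poly_of_coeffs[OF permutes_bij[OF \<sigma>(1)]]
      by (simp add: \<phi>.hom_sum \<phi>_single eval_var)
    then show "s \<in> Sn_orbit n (poly_of_coeffs A c)" using \<sigma>(1) by (auto simp: Sn_orbit_def)
  qed
  then have "\<phi> (Poly_Mapping.single 0 p * sqfree_mono k ^ N) \<in> ideal_gen (Sn_orbit n (poly_of_coeffs A c))"
    by (rule hom_ideal_gen[OF \<phi>.comm_ring_hom_axioms assms(1)])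
  also have "\<phi> (Poly_Mapping.single 0 p * sqfree_mono k ^ N) = Poly_Mapping.single 0 (eval_poly p c) * sqfree_mono k ^ N"
    by (simp add: \<phi>.hom_mult \<phi>.hom_power \<phi>_single sqfree_mono_def eval_one)
  finally have "Poly_Mapping.single 0 (inverse (eval_poly p c)) * (Poly_Mapping.single 0 (eval_poly p c) * sqfree_mono k ^ N)
      \<in> ideal_gen (Sn_orbit n (poly_of_coeffs A c))"
    by (rule ring_ideal.mult[OF ring_ideal_ideal_gen])
  then show ?thesis using assms(2) by (simp add: mult_single flip: mult.assoc)
qed

text \<open>The ideal of an orbit is stable under the action, so it contains the same power of every
  permuted \<open>sqfree_mono k\<close>; the radical, being an ideal, contains what these
  generate.\<close>

lemma sqfree_ideal_subset_radical:
  fixes f :: "'k::comm_ring_1 mpoly"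
  assumes "sqfree_mono k ^ N \<in> ideal_gen (Sn_orbit n f)"
  shows "ideal_gen (Sn_orbit n (sqfree_mono k)) \<subseteq> radical (ideal_gen (Sn_orbit n f))"
proof (rule ideal_gen_least[OF ring_ideal_radical[OF ring_ideal_ideal_gen]])
  show "Sn_orbit n (sqfree_mono k) \<subseteq> radical (ideal_gen (Sn_orbit n f))"
  proof
    fix s :: "'k mpoly" assume "s \<in> Sn_orbit n (sqfree_mono k)"
    then obtain \<sigma> where \<sigma>: "\<sigma> permutes {..<n}" "s = perm_poly \<sigma> (sqfree_mono k)"
      by (auto simp: Sn_orbit_def)
    interpret comm_ring_hom "perm_poly \<sigma> :: 'k mpoly \<Rightarrow> _"
      by (intro comm_ring_hom_perm_poly permutes_bij[OF \<sigma>(1)])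
    have "perm_poly \<sigma> (sqfree_mono k ^ N) \<in> ideal_gen (Sn_orbit n f)"
      by (rule hom_ideal_gen[OF comm_ring_hom_axioms assms]) (auto intro: perm_poly_Sn_orbit[OF \<sigma>(1)])
    then show "s \<in> radical (ideal_gen (Sn_orbit n f))"
      unfolding radical_def \<sigma>(2) by (auto simp: hom_power)
  qed
qed

theorem theorem1p1:
  fixes n :: nat and A :: "(nat \<Rightarrow>\<^sub>0 nat) set"
  assumes n5: "n \<ge> 5"
    and A_fin: "finite A" and A_ne: "A \<noteq> {}"
    and A_vars: "\<forall>\<alpha>\<in>A. Poly_Mapping.keys \<alpha> \<subseteq> {..<n}"
    and A_hom: "\<forall>\<alpha>\<in>A. \<forall>\<beta>\<in>A. exp_deg \<alpha> = exp_deg \<beta>"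
    and A_sym: "\<forall>\<sigma> \<alpha>. \<sigma> permutes {..<n} \<longrightarrow> \<alpha> \<in> A \<longrightarrow> perm_exp \<sigma> \<alpha> \<in> A"
    and k_def: "k = Min ((\<lambda>\<alpha>. card (Poly_Mapping.keys \<alpha>)) ` A)"
  shows "general_coeffs A (\<lambda>c :: (nat \<Rightarrow>\<^sub>0 nat) \<Rightarrow> 'k::field_char_0.
           radical (ideal_gen (Sn_orbit n (poly_of_coeffs A c)))
             = ideal_gen (Sn_orbit n (sqfree_mono k)))"
proof -
  have "k \<in> (\<lambda>\<alpha>. card (Poly_Mapping.keys \<alpha>)) ` A"
    unfolding k_def using A_fin A_ne by (intro Min_in) auto
  then obtain \<gamma> where \<gamma>: "\<gamma> \<in> A" "card (Poly_Mapping.keys \<gamma>) = k" by auto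
  have k_le: "k \<le> card (Poly_Mapping.keys \<alpha>)" if "\<alpha> \<in> A" for \<alpha>
    unfolding k_def using A_fin that by (intro Min_le) auto
  obtain p :: "((nat \<Rightarrow>\<^sub>0 nat) \<Rightarrow>\<^sub>0 nat) \<Rightarrow>\<^sub>0 'k" and N where p: "p \<noteq> 0"
    "\<forall>m\<in>Poly_Mapping.keys p. Poly_Mapping.keys m \<subseteq> A"
    "Poly_Mapping.single 0 p * sqfree_mono k ^ N \<in> ideal_gen (Sn_orbit n (poly_of_coeffs A var))"
  proof -
    have "n > 0" using n5 by simp
    moreover have "\<And>\<alpha>. \<alpha> \<in> A \<Longrightarrow> exp_deg \<alpha> = exp_deg \<gamma>" using A_hom \<gamma>(1) by blast
    ultimately show ?thesis
      using that generic_monomial_power_in_ideal[OF _ A_fin A_vars[rule_format] _ A_sym[rule_format] \<gamma> refl]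
      by blast
  qed
  show ?thesis
    unfolding general_coeffs_def
  \<comment> \<open>Nonvanishing of \<open>p\<close> puts the monomial ideal inside the radical; the
    opposite inclusion comes from the minimality of \<open>k\<close>.\<close>
  proof (intro exI[of _ p] conjI allI impI p(1,2))
    fix c :: "(nat \<Rightarrow>\<^sub>0 nat) \<Rightarrow> 'k" assume "eval_poly p c \<noteq> 0"
    then have "sqfree_mono k ^ N \<in> ideal_gen (Sn_orbit n (poly_of_coeffs A c))"
      by (rule specialised_monomial_power_in_ideal[OF p(3)])
    then show "radical (ideal_gen (Sn_orbit n (poly_of_coeffs A c))) = ideal_gen (Sn_orbit n (sqfree_mono k))"
      using A_vars k_le by (intro equalityI radical_subset_sqfree_ideal sqfree_ideal_subset_radical) auto
  qed
qed

end
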